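(* Suppose $\operatorname{char}\mathcal{F}=p>0$ (so $\mathcal{F}=\mathbb{F}_q((\pi))$). (a) For every $x\in\mathcal{F}$ with $|x|_\mathfrak{p}>1$, the sequence $([x^n])_{n\ge1}$ is not $\mu$-uniformly distributed in $\mathcal{O}$. (b) For each positive integer $k$, for Haar-almost every $x\in\mathcal{F}$ with $|x|_\mathfrak{p}>1$, the subsequence $([x^n])_{n\ge1,\ p^k\parallel n}$ (indexed by those $n$ with $p^k\mid n$, $p^{k+1}\nmid n$) is $\mu_k$-uniformly distributed (in $\widetilde{\mathcal{S}_k}$). (c) For Haar-almost every $x\in\mathcal{F}$ with $|x|_\mathfrak{p}>1$, the sequence $([x^n])_{n\ge1}$ is $\mu^*$-uniformly distributed in $\mathcal{O}$.
   Context: $\mathcal{F}=\mathbb{F}_q((\pi))$ with valuation ring $\mathcal{O}=\mathbb{F}_q[[\pi]]$, normalized absolute value $|x|_\mathfrak{p}=q^{-v_\mathfrak{p}(x)}$; elements are written $x=\sum_{i\ge v_\mathfrak{p}(x)}c_i\pi^i$ with $c_i\in\mathbb{F}_q$, and $[x]=\sum_{i\ge0}c_i\pi^i$. $\mu$ is the Haar measure on $\mathcal{F}$ normalized by $\mu(\mathcal{O})=1$. For $k\ge1$, $\mathcal{S}_k=\{x=\sum c_i\pi^i\in\mathcal{F}: c_i=0\text{ whenever }p^k\nmid i\}$, $\widetilde{\mathcal{S}_k}=\mathcal{S}_k\cap\mathcal{O}$ (a closed additive subgroup of $\mathcal{O}$), and $\mu_k$ is the Haar measure of $\mathcal{S}_k$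 normalized by $\mu_k(\widetilde{\mathcal{S}_k})=1$, viewed also as a measure on $\mathcal{O}$ via $D\mapsto\mu_k(D\cap\widetilde{\mathcal{S}_k})$. Define the Borel probability measure $\mu^*$ on $\mathcal{O}$ by $\mu^*(D)=(1-\frac1p)\big(\mu(D)+\sum_{k\ge1}p^{-k}\mu_k(D\cap\widetilde{\mathcal{S}_k})\big)$ for disks $D\subset\mathcal{O}$. For a Borel probability measure $\nu$ on a compact space $X$, a sequence $(x_n)\subset X$ is $\nu$-uniformly distributed if $\frac1N\sum_{n=1}^N\delta_{x_n}\to\nu$ in the weak-* topology. *)

theory Defs
  imports "HOL-Probability.Probability"
          "HOL-Computational_Algebra.Formal_Laurent_Series"
          "HOL-Library.Infinite_Set"
begin

text \<open>The local field F = F_q((pi)) is modelled as the type 'a fls of formal Laurent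
  series over a finite field 'a (q = CARD('a), p = CHAR('a)).  The valuation ring O is
  modelled by its coefficient sequences nat => 'a, with the product of discrete
  topologies (which is exactly the pi-adic topology on O).\<close>

definition abs_p :: "'a::{finite,field} fls \<Rightarrow> real" where
  "abs_p x = (if x = 0 then 0
              else real CARD('a) powr (- real_of_int (fls_subdegree x)))"

definition int_part :: "'a::zero fls \<Rightarrow> (nat \<Rightarrow> 'a)" where
  "int_part x = (\<lambda>i. fls_nth x (int i))"

definition O_top :: "(nat \<Rightarrow> 'a) topology" where
  "O_top = product_topology (\<lambda>_. discrete_topology UNIV) UNIV"

definition unif :: "'a::finite measure" where
  "unif = measure_pmf (pmf_of_set UNIV)"

definition haar_O :: "(nat \<Rightarrow> 'a::finite) measure" where
  "haar_O = PiM UNIV (\<lambda>_. unif)"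

text \<open>mu_k: normalised Haar measure of the closed subgroup S_k~ of O, viewed on O.\<close>
definition mu_k :: "nat \<Rightarrow> (nat \<Rightarrow> 'a::{finite,field}) measure" where
  "mu_k k = PiM UNIV (\<lambda>i. if CHAR('a) ^ k dvd i then unif
                          else measure_pmf (return_pmf 0))"

definition mu_star :: "(nat \<Rightarrow> 'a::{finite,field}) measure" where
  "mu_star = measure_of UNIV (sets (haar_O :: (nat \<Rightarrow> 'a) measure))
     (\<lambda>A. ennreal (1 - 1 / real CHAR('a)) *
          (emeasure haar_O A +
           (\<Sum>k. ennreal (1 / real CHAR('a) ^ Suc k) * emeasure (mu_k (Suc k)) A)))"

definition unif_distr :: "(nat \<Rightarrow> 'a) measure \<Rightarrow> (nat \<Rightarrow> (nat \<Rightarrow> 'a)) \<Rightarrow> bool" where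
  "unif_distr \<nu> s \<longleftrightarrow>
     (\<forall>f. continuous_map O_top euclideanreal f \<longrightarrow>
        (\<lambda>N. (\<Sum>n<N. f (s n)) / real N) \<longlonglongrightarrow> integral\<^sup>L \<nu> f)"

definition lift_O :: "nat \<Rightarrow> (nat \<Rightarrow> 'a::zero) \<Rightarrow> 'a fls" where
  "lift_O m c = fls_shift (int m) (fps_to_fls (Abs_fps c))"

text \<open>Haar-almost every x in F: F is the increasing union of the balls pi^(-m) O, each
  of which carries (a multiple of) the image of mu under lift_O m.\<close>
definition haar_AE :: "('a::{finite,zero} fls \<Rightarrow> bool) \<Rightarrow> bool" where
  "haar_AE P \<longleftrightarrow> (\<forall>m. AE c in haar_O. P (lift_O m c))"

end

(* Suppose x has a pole of order d and p does not divide n. Up to a shift by d n, the n-th power of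
   x is the n-th power of a power series u with u_0 \<noteq> 0, whose j-th coefficient is
   n u_0^(n-1) u_j plus a function of u_0, ..., u_(j-1). Hence replacing u_j by that coefficient is a
   triangular, measure-preserving change of coordinates, and the first L coefficients of [x^n] and
   [x^m] are independent and uniform as soon as the windows starting at d n and d m are disjoint.
   A second moment estimate along the squares then gives uniform distribution along any increasing
   sequence of exponents prime to p. Raising to the power p^k pushes the Haar measure to mu_k and
   handles the exponents n with p^k || n, which have density (1 - 1/p) p^(-k); summing over k by
   Tannery's theorem gives mu_star. Conversely, for p | n the coefficients of x^n at indices prime
   to p vanish, which happens too often for Haar measure. *)
theory Submission
  imports Defs "HOL-Library.Discrete_Functions" "HOL-Real_Asymp.Real_Asymp"
begin

section \<open>A law of large numbers for events that are independent at distance L\<close>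

text \<open>The change of coordinates makes sense only where u_0 is nonzero and p does not divide
  the exponent, and the order of the pole and the index of the leading coefficient vary with the
  point. Two devices remove these restrictions. The map is made total by leaving a coordinate
  unchanged wherever the power is of no use, so that the events considered have exact probabilities
  on the whole space and agree with the wanted ones where u_0 is nonzero. The data depending on the
  point take only countably many values, and there are only countably many disks, so one null set
  serves them all; shift invariance of Haar measure handles the leading zeros. The squares enter
  because the mean square of an average of N centred terms is only known to be O(1/N), which is not
  summable, whereas for N^2 terms it is O(1/N^2).\<close>

lemma average_tendsto_0_of_squares:
  fixes x :: "nat \<Rightarrow> real"
  assumes bd: "\<And>n. \<bar>x n\<bar> \<le> 1"
    and sq: "(\<lambda>N. (\<Sum>n<N^2. x n) / real (N^2)) \<longlonglongrightarrow> 0"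
  shows "(\<lambda>N. (\<Sum>n<N. x n) / real N) \<longlonglongrightarrow> 0"
proof -
  define S where "S N = (\<Sum>n<N. x n)" for N
  define r where "r N = floor_sqrt N" for N
  have r: "filterlim r at_top sequentially"
    unfolding r_def
    unfolding filterlim_at_top
  proof
    fix Z show "\<forall>\<^sub>F N in sequentially. Z \<le> floor_sqrt N"
      using eventually_ge_at_top[of "Z^2"] by eventually_elim (simp add: le_floor_sqrtI)
  qed
  \<comment> \<open>Fewer than \<open>2 * r N + 1\<close> terms, each at most 1 in absolute value,
    lie beyond the last square below \<open>N\<close>; after division they contribute O(1 /
    \<open>r N\<close>).\<close>
  have bound: "\<bar>S N / real N\<bar> \<le> \<bar>S ((r N)^2) / real ((r N)^2)\<bar> + (2 * real (r N) + 1) / real (r N)^2"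
    if "N > 0" for N
  proof -
    have le: "(r N)^2 \<le> N" and gt: "N < (r N + 1)^2"
      using Suc_floor_sqrt_power2_gt[of N] by (simp_all add: r_def)
    have rpos: "r N > 0" using that by (simp add: r_def)
    have "S N = S ((r N)^2) + (\<Sum>n=(r N)^2..<N. x n)"
    proof -
      have "{..<N} = {..<(r N)^2} \<union> {(r N)^2..<N}" using le by auto
      hence "S N = sum x ({..<(r N)^2} \<union> {(r N)^2..<N})" unfolding S_def by (rule arg_cong)
      also have "\<dots> = S ((r N)^2) + (\<Sum>n=(r N)^2..<N. x n)"
        unfolding S_def by (rule sum.union_disjoint) auto
      finally show ?thesis .
    qed
    moreover have "\<bar>\<Sum>n=(r N)^2..<N. x n\<bar> \<le> (\<Sum>n=(r N)^2..<N. 1)"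
      by (intro order.trans[OF sum_abs] sum_mono bd)
    moreover have "real (N - (r N)^2) \<le> 2 * real (r N) + 1"
    proof -
      have "(r N + 1)^2 = (r N)^2 + (2 * r N + 1)" unfolding power2_eq_square by simp
      hence "N - (r N)^2 \<le> 2 * r N + 1" using gt by simp
      thus ?thesis by linarith
    qed
    ultimately have "\<bar>S N\<bar> \<le> \<bar>S ((r N)^2)\<bar> + (2 * real (r N) + 1)" by simp
    hence "\<bar>S N / real N\<bar> \<le> (\<bar>S ((r N)^2)\<bar> + (2 * real (r N) + 1)) / real N"
      by (simp add: divide_right_mono)
    also have "\<dots> \<le> (\<bar>S ((r N)^2)\<bar> + (2 * real (r N) + 1)) / real ((r N)^2)"
      using le rpos by (intro divide_left_mono mult_pos_pos) (use that in \<open>auto simp del: of_nat_power\<close>)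
    also have "\<dots> = \<bar>S ((r N)^2) / real ((r N)^2)\<bar> + (2 * real (r N) + 1) / real (r N)^2"
      unfolding add_divide_distrib abs_divide by simp
    finally show ?thesis .
  qed
  have "(\<lambda>N. \<bar>S (N^2) / real (N^2)\<bar> + (2 * real N + 1) / real N^2) \<longlonglongrightarrow> \<bar>0\<bar> + 0"
  proof (intro tendsto_add tendsto_rabs)
    show "(\<lambda>N. (2 * real N + 1) / real N^2) \<longlonglongrightarrow> 0" by real_asymp
  qed (use sq in \<open>simp add: S_def\<close>)
  from filterlim_compose[OF this r]
  have lim: "(\<lambda>N. \<bar>S ((r N)^2) / real ((r N)^2)\<bar> + (2 * real (r N) + 1) / real (r N)^2) \<longlonglongrightarrow> 0"
    by simp
  have "(\<lambda>N. S N / real N) \<longlonglongrightarrow> 0"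
  proof (rule Lim_null_comparison[OF _ lim])
    show "\<forall>\<^sub>F N in sequentially. norm (S N / real N)
        \<le> \<bar>S ((r N)^2) / real ((r N)^2)\<bar> + (2 * real (r N) + 1) / real (r N)^2"
      unfolding real_norm_def by (rule eventually_mono[OF eventually_gt_at_top[of 0] bound])
  qed
  thus ?thesis by (simp add: S_def)
qed

text \<open>Orthogonality at distance \<open>L\<close> leaves only a diagonal band of the double
  sum, with at most \<open>2 * L\<close> entries in each row and each entry at most 1.\<close>

lemma (in prob_space) second_moment_le:
  fixes X :: "nat \<Rightarrow> 'a \<Rightarrow> real"
  assumes X[measurable]: "\<And>n. X n \<in> borel_measurable M" and bd: "\<And>n x. \<bar>X n x\<bar> \<le> 1"
    and orth: "\<And>n m. n + L \<le> m \<Longrightarrow> expectation (\<lambda>x. X n x * X m x) = 0"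
  shows "expectation (\<lambda>x. (\<Sum>n<N. X n x)^2) \<le> 2 * real L * real N"
proof -
  have int: "integrable M (\<lambda>x. X n x * X m x)" for n m
    by (rule integrable_const_bound[where B = 1]) (auto simp: abs_mult intro!: mult_le_one bd)
  have "expectation (\<lambda>x. (\<Sum>n<N. X n x)^2) = (\<Sum>n<N. \<Sum>m<N. expectation (\<lambda>x. X n x * X m x))"
    by (simp add: power2_eq_square sum_product int)
  \<comment> \<open>Truncated subtraction does no harm: \<open>m\<close> lies outside the band
    exactly when \<open>n + L \<le> m\<close> or \<open>m + L \<le> n\<close>.\<close>
  also have "\<dots> \<le> (\<Sum>n<N. \<Sum>m<N. if m \<in> {Suc n - L..<n + L} then 1 else 0)"
  proof (intro sum_mono)
    fix n m
    have "expectation (\<lambda>x. X n x * X m x) \<le> 1"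
    proof -
      have "X n x * X m x \<le> 1" for x
      proof -
        have "\<bar>X n x\<bar> * \<bar>X m x\<bar> \<le> 1" using bd[of n x] bd[of m x] by (simp add: mult_le_one)
        thus ?thesis using abs_ge_self[of "X n x * X m x"] unfolding abs_mult by linarith
      qed
      hence "expectation (\<lambda>x. X n x * X m x) \<le> expectation (\<lambda>_. 1)"
        by (intro integral_mono int integrable_const)
      thus ?thesis by (simp add: prob_space)
    qed
    moreover have "expectation (\<lambda>x. X n x * X m x) = 0" if "m \<notin> {Suc n - L..<n + L}"
    proof -
      from that have "n + L \<le> m \<or> m + L \<le> n" by auto
      thus ?thesis using orth[of n m] orth[of m n] by (auto simp: mult.commute)
    qed
    ultimately show "expectation (\<lambda>x. X n x * X m x)
        \<le> (if m \<in> {Suc n - L..<n + L} then 1 else 0)" by auto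
  qed
  also have "\<dots> \<le> (\<Sum>n<N. 2 * real L)"
  proof (intro sum_mono)
    fix n
    have "(\<Sum>m<N. if m \<in> {Suc n - L..<n + L} then 1 else 0 :: real)
        = real (card ({..<N} \<inter> {Suc n - L..<n + L}))"
      by (subst sum.inter_restrict[symmetric]) simp_all
    also have "\<dots> \<le> real (card {Suc n - L..<n + L})"
      by (intro of_nat_mono card_mono) auto
    also have "\<dots> \<le> 2 * real L" by simp
    finally show "(\<Sum>m<N. if m \<in> {Suc n - L..<n + L} then 1 else 0) \<le> 2 * real L" .
  qed
  finally show ?thesis by (simp add: mult.commute)
qed

text \<open>The expected squares of the averages of N^2 terms form a summable series, so the squares
  themselves have a finite sum almost everywhere and tend to 0; the gaps between squares are filled
  afterwards.\<close>

lemma (in prob_space) AE_average_tendsto_0: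
  fixes X :: "nat \<Rightarrow> 'a \<Rightarrow> real"
  assumes X[measurable]: "\<And>n. X n \<in> borel_measurable M" and bd: "\<And>n x. \<bar>X n x\<bar> \<le> 1"
    and orth: "\<And>n m. n + L \<le> m \<Longrightarrow> expectation (\<lambda>x. X n x * X m x) = 0"
  shows "AE x in M. (\<lambda>N. (\<Sum>n<N. X n x) / real N) \<longlonglongrightarrow> 0"
proof -
  define T where "T N x = ((\<Sum>n<N^2. X n x) / real (N^2))^2" for N x
  have [measurable]: "T N \<in> borel_measurable M" for N unfolding T_def by measurable
  have T_int: "integrable M (T N)" and T_le: "expectation (T N) \<le> 2 * real L * (1 / real N ^ 2)"
    if "N > 0" for N
  proof -
    have "\<bar>(\<Sum>n<N^2. X n x) / real (N^2)\<bar> \<le> 1" for x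
    proof -
      have "\<bar>\<Sum>n<N^2. X n x\<bar> \<le> (\<Sum>n<N^2. 1)" by (intro order.trans[OF sum_abs] sum_mono bd)
      thus ?thesis using that by simp
    qed
    hence "\<bar>T N x\<bar> \<le> 1" for x by (auto simp: T_def abs_square_le_1)
    thus "integrable M (T N)" by (intro integrable_const_bound[where B = 1]) auto
    have "expectation (T N) = expectation (\<lambda>x. (\<Sum>n<N^2. X n x)^2) / real (N^2)^2"
      unfolding T_def power_divide by simp
    also have "\<dots> \<le> (2 * real L * real (N^2)) / real (N^2)^2"
      by (intro divide_right_mono second_moment_le X bd orth) auto
    finally show "expectation (T N) \<le> 2 * real L * (1 / real N ^ 2)"
      using that by (simp add: power2_eq_square)
  qed
  have sm: "summable (\<lambda>N. 2 * real L * (1 / real (Suc N) ^ 2))"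
  proof (rule summable_mult)
    have "summable (\<lambda>N. inverse (real N ^ 2))" by (rule inverse_power_summable) simp
    hence "summable (\<lambda>N. inverse (real (Suc N) ^ 2))" by (subst summable_Suc_iff[of "\<lambda>N. inverse (real N ^ 2)"])
    thus "summable (\<lambda>N. 1 / real (Suc N) ^ 2)" by (simp only: inverse_eq_divide)
  qed
  \<comment> \<open>The index \<open>Suc N\<close> skips \<open>N = 0\<close>, where the average
    divides by zero and no bound on \<open>T\<close> was shown.\<close>
  have "(\<integral>\<^sup>+x. (\<Sum>N. ennreal (T (Suc N) x)) \<partial>M) = (\<Sum>N. \<integral>\<^sup>+x. ennreal (T (Suc N) x) \<partial>M)"
    by (rule nn_integral_suminf) measurable
  also have "\<dots> = (\<Sum>N. ennreal (expectation (T (Suc N))))"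
    by (intro suminf_cong nn_integral_eq_integral T_int) (auto simp: T_def)
  also have "\<dots> \<le> (\<Sum>N. ennreal (2 * real L * (1 / real (Suc N) ^ 2)))"
    by (intro suminf_le ennreal_leI T_le) auto
  also have "\<dots> < \<infinity>"
    using sm by (subst suminf_ennreal2) auto
  finally have "AE x in M. (\<Sum>N. ennreal (T (Suc N) x)) \<noteq> \<infinity>"
    by (intro nn_integral_PInf_AE) auto
  thus ?thesis
  proof eventually_elim
    case (elim x)
    hence "summable (\<lambda>N. T (Suc N) x)"
      by (intro summable_suminf_not_top) (auto simp: T_def)
    hence "(\<lambda>N. T N x) \<longlonglongrightarrow> 0"
      by (intro summable_LIMSEQ_zero) (subst (asm) summable_Suc_iff[of "\<lambda>N. T N x"])
    hence "(\<lambda>N. sqrt (T N x)) \<longlonglongrightarrow> sqrt 0" by (rule tendsto_real_sqrt)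
    hence "(\<lambda>N. (\<Sum>n<N^2. X n x) / real (N^2)) \<longlonglongrightarrow> 0"
      unfolding T_def real_sqrt_abs real_sqrt_zero by (rule tendsto_rabs_zero_cancel)
    thus ?case by (intro average_tendsto_0_of_squares bd)
  qed
qed

text \<open>Subtracting \<open>r\<close> turns independence of two events of probability
  \<open>r\<close> into orthogonality of the centred indicators.\<close>

lemma (in prob_space) AE_frequency_tendsto:
  fixes A :: "nat \<Rightarrow> 'a set"
  assumes A[measurable]: "\<And>n. A n \<in> events" and r: "\<And>n. prob (A n) = r"
    and indep: "\<And>n m. n + L \<le> m \<Longrightarrow> prob (A n \<inter> A m) = r * r"
  shows "AE x in M. (\<lambda>N. (\<Sum>n<N. indicator (A n) x) / real N) \<longlonglongrightarrow> r"
proof -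
  have r01: "0 \<le> r" "r \<le> 1" using r[of 0] by (auto simp flip: r)
  have "AE x in M. (\<lambda>N. (\<Sum>n<N. indicator (A n) x - r) / real N) \<longlonglongrightarrow> 0"
  proof (rule AE_average_tendsto_0)
    show "\<bar>indicator (A n) x - r\<bar> \<le> 1" for n x
      using r01 by (auto simp: indicator_def)
    fix n m assume "n + L \<le> m"
    have "expectation (\<lambda>x. (indicator (A n) x - r) * (indicator (A m) x - r))
        = expectation (\<lambda>x. indicator (A n \<inter> A m) x - r * indicator (A n) x - r * indicator (A m) x + r * r)"
      by (intro Bochner_Integration.integral_cong) (auto simp: indicator_def algebra_simps)
    also have "\<dots> = 0"
    proof -
      have int: "integrable M (indicat_real B)" if "B \<in> events" for B
        using that by (intro integrable_real_indicator) (auto simp: emeasure_eq_measure)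
      show ?thesis
        using indep[OF \<open>n + L \<le> m\<close>]
        by (subst Bochner_Integration.integral_add Bochner_Integration.integral_diff;
            auto intro!: Bochner_Integration.integrable_diff integrable_mult_right int simp: r prob_space)+
    qed
    finally show "expectation (\<lambda>x. (indicator (A n) x - r) * (indicator (A m) x - r)) = 0" .
  qed auto
  thus ?thesis
  proof eventually_elim
    case (elim x)
    from tendsto_add[OF this tendsto_const[of r]]
    show ?case
      unfolding add_0_left
    proof (rule Lim_transform_eventually)
      show "\<forall>\<^sub>F N in sequentially. (\<Sum>n<N. indicator (A n) x - r) / real N + r
          = (\<Sum>n<N. indicator (A n) x) / real N"
        using eventually_gt_at_top[of 0]
        by eventually_elim (simp add: sum_subtractf diff_divide_distrib)
    qed
  qed
qed

section \<open>Cylinders and triangular maps\<close>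

text \<open>These are the disks of the valuation ring: a word of length L gives a ball of radius
  q^(-L).\<close>

definition cyl :: "'a list \<Rightarrow> (nat \<Rightarrow> 'a) set" where
  "cyl w = {c. \<forall>i<length w. c i = w ! i}"

lemma cyl_Nil [simp]: "cyl [] = UNIV"
  by (simp add: cyl_def)

section \<open>Haar measure as a product measure and its values on disks\<close>

lemma space_unif [simp]: "space unif = UNIV" and sets_unif [simp]: "sets unif = UNIV"
  by (simp_all add: unif_def)

lemma prob_space_unif: "prob_space unif"
  unfolding unif_def by (rule prob_space_measure_pmf)

lemma space_haar_O [simp]: "space haar_O = UNIV"
  by (simp add: haar_O_def space_PiM PiE_UNIV_domain)

lemma prob_space_haar_O: "prob_space haar_O"
  unfolding haar_O_def by (intro prob_space_PiM prob_space_unif)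

lemma prob_space_mu_k: "prob_space (mu_k k)"
  unfolding mu_k_def by (intro prob_space_PiM) (simp add: prob_space_unif prob_space_measure_pmf)

lemma sets_mu_k [measurable_cong]: "sets (mu_k k) = sets haar_O"
  unfolding mu_k_def haar_O_def by (intro sets_PiM_cong) auto

lemma mu_k_0: "mu_k 0 = haar_O"
  by (simp add: mu_k_def haar_O_def)

text \<open>Two disks are nested or disjoint, as in any ultrametric space, hence the added empty
  set. The disks thus form a pi-system, on which probability measures can be compared.\<close>

lemma Int_stable_cyl: "Int_stable (insert {} (range cyl))"
proof -
  have "cyl v \<inter> cyl w \<in> insert {} (range cyl)" for v w :: "'a list"
  proof (cases "cyl v \<inter> cyl w = {}")
    case False
    then obtain c where c: "c \<in> cyl v" "c \<in> cyl w" by auto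
    have "cyl v \<inter> cyl w = (if length v \<le> length w then cyl w else cyl v)"
      using c by (auto simp: cyl_def dest: order.strict_trans2 order.strict_trans1)
    thus ?thesis by auto
  qed auto
  thus ?thesis by (auto simp: Int_stable_def)
qed

lemma local_eq_UN_cyl:
  fixes A :: "(nat \<Rightarrow> 'a::finite) set"
  assumes loc: "\<And>c c'. (\<forall>i<M. c i = c' i) \<Longrightarrow> c \<in> A \<Longrightarrow> c' \<in> A"
  obtains W where "finite W" "A = (\<Union>w\<in>W. cyl w)"
proof
  define W where "W = {w :: 'a list. set w \<subseteq> UNIV \<and> length w = M} \<inter> {w. cyl w \<subseteq> A}"
  show "finite W" unfolding W_def by (intro finite_Int disjI1 finite_lists_length_eq) simp
  show "A = (\<Union>w\<in>W. cyl w)"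
  proof (intro equalityI subsetI)
    fix c assume c: "c \<in> A"
    have "cyl (map c [0..<M]) \<subseteq> A"
      using loc[OF _ c] by (auto simp: cyl_def)
    hence "map c [0..<M] \<in> W" by (simp add: W_def)
    moreover have "c \<in> cyl (map c [0..<M])" by (simp add: cyl_def)
    ultimately show "c \<in> (\<Union>w\<in>W. cyl w)" by blast
  qed (auto simp: W_def)
qed

lemma sets_haar_O: "sets haar_O = sigma_sets UNIV (insert {} (range (cyl :: 'a::finite list \<Rightarrow> _)))"
  (is "_ = sigma_sets _ ?E")
proof -
  have cyl: "cyl w \<in> sets haar_O" for w :: "'a list"
  proof -
    have "(\<lambda>c. c i) \<in> measurable haar_O (unif :: 'a measure)" for i :: nat
      unfolding haar_O_def by (rule measurable_component_singleton) simp
    hence "(\<lambda>c. c i) -` {w ! i} \<inter> space haar_O \<in> sets haar_O" for i :: nat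
      by (rule measurable_sets) simp
    hence "{c \<in> space haar_O. c i \<in> {w ! i}} \<in> sets haar_O" for i
      by (simp add: vimage_def)
    hence "(\<Inter>i\<in>{..<length w}. {c \<in> space haar_O. c i \<in> {w ! i}}) \<in> sets haar_O" if "w \<noteq> []"
      using that by (intro sets.finite_INT) auto
    moreover have "(\<Inter>i\<in>{..<length w}. {c \<in> space haar_O. c i \<in> {w ! i}}) = cyl w"
      by (auto simp: cyl_def)
    ultimately show ?thesis using sets.top[of haar_O] by (cases "w = []") auto
  qed
  have "sets haar_O = sigma_sets UNIV {{f\<in>UNIV. f i \<in> A} | i (A :: 'a set). True}"
    by (simp add: haar_O_def sets_PiM_single PiE_UNIV_domain)
  also have "\<dots> = sigma_sets UNIV ?E"
  proof (rule sigma_sets_eqI)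
    fix B :: "(nat \<Rightarrow> 'a) set" assume "B \<in> {{f\<in>UNIV. f i \<in> A} | i A. True}"
    then obtain i A where B: "B = {f. f i \<in> A}" by auto
    obtain W where "finite W" "B = (\<Union>w\<in>W. cyl w)"
      by (rule local_eq_UN_cyl[where M = "Suc i" and A = B]) (auto simp: B)
    thus "B \<in> sigma_sets UNIV ?E"
      by (auto intro!: sigma_sets_UNION countable_finite)
  next
    fix B assume "B \<in> ?E"
    thus "B \<in> sigma_sets UNIV {{f\<in>UNIV. f i \<in> A} | i (A :: 'a set). True}"
      using cyl by (auto simp: calculation intro: sigma_sets.Empty)
  qed
  finally show ?thesis .
qed

lemma cyl_in_sets [measurable]: "cyl w \<in> sets (haar_O :: (nat \<Rightarrow> 'a::finite) measure)"
  unfolding sets_haar_O by (rule sigma_sets.Basic) simp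

lemma local_in_sets:
  fixes A :: "(nat \<Rightarrow> 'a::finite) set"
  assumes "\<And>c c'. (\<forall>i<M. c i = c' i) \<Longrightarrow> c \<in> A \<Longrightarrow> c' \<in> A"
  shows "A \<in> sets haar_O"
proof -
  obtain W where "finite W" "A = (\<Union>w\<in>W. cyl w)"
    using local_eq_UN_cyl[of M A] assms by metis
  thus ?thesis by auto
qed

lemma measurable_local:
  fixes \<Phi> :: "(nat \<Rightarrow> 'a::finite) \<Rightarrow> (nat \<Rightarrow> 'a)"
  assumes "\<And>i c c'. (\<forall>j<B i. c j = c' j) \<Longrightarrow> \<Phi> c i = \<Phi> c' i"
  shows "\<Phi> \<in> measurable haar_O haar_O"
proof -
  have "(\<lambda>c. \<Phi> c i) \<in> measurable haar_O unif" for i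
  proof (rule measurableI)
    fix A :: "'a set"
    show "(\<lambda>c. \<Phi> c i) -` A \<inter> space haar_O \<in> sets haar_O"
      by (rule local_in_sets[where M = "B i"]) (use assms in \<open>auto, metis\<close>)
  qed auto
  hence "(\<lambda>c i. \<Phi> c i) \<in> measurable haar_O (PiM UNIV (\<lambda>_. unif))"
    by (intro measurable_PiM_single') (auto simp: PiE_UNIV_domain)
  thus ?thesis by (simp flip: haar_O_def)
qed

lemma measure_eqI_cyl:
  fixes M N :: "(nat \<Rightarrow> 'a::finite) measure"
  assumes "prob_space M" "prob_space N" "sets M = sets haar_O" "sets N = sets haar_O"
    and eq: "\<And>w. measure M (cyl w) = measure N (cyl w)"
  shows "M = N"
proof (rule measure_eqI_generator_eq[OF Int_stable_cyl, where \<Omega> = UNIV and A = "\<lambda>_. UNIV"])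
  interpret M: prob_space M by fact
  interpret N: prob_space N by fact
  show "emeasure M X = emeasure N X" if "X \<in> insert {} (range cyl)" for X
    using that eq by (auto simp: M.emeasure_eq_measure N.emeasure_eq_measure)
  show "emeasure M UNIV \<noteq> \<infinity>" by (simp add: M.emeasure_eq_measure)
  show "range (\<lambda>i::nat. UNIV) \<subseteq> insert {} (range (cyl :: 'a list \<Rightarrow> _))"
    using rangeI[of cyl "[]"] by auto
qed (use assms in \<open>simp_all add: sets_haar_O\<close>)

lemma measure_haar_O_Collect:
  fixes a :: "nat \<Rightarrow> 'a::finite"
  assumes "finite J"
  shows "measure haar_O {c. \<forall>i\<in>J. c i = a i} = 1 / real CARD('a) ^ card J"
proof -
  interpret product_prob_space "\<lambda>_::nat. unif :: 'a measure" UNIV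
    by (simp add: product_prob_space_def product_prob_space_axioms_def product_sigma_finite_def
        prob_space_unif prob_space_imp_sigma_finite)
  interpret H: prob_space "haar_O :: (nat \<Rightarrow> 'a) measure" by (rule prob_space_haar_O)
  have "emeasure haar_O {c. \<forall>i\<in>J. c i = a i} = (\<Prod>i\<in>J. emeasure unif {a i})"
    using emeasure_PiM_Collect[of J "\<lambda>i. {a i}"] assms
    by (simp add: PiE_UNIV_domain space_PiM flip: haar_O_def)
  also have "\<dots> = ennreal (1 / real CARD('a) ^ card J)"
    by (simp add: unif_def emeasure_pmf_single ennreal_power power_one_over)
  finally show ?thesis by (simp add: H.emeasure_eq_measure)
qed

lemma measure_haar_O_Collect_less:
  fixes a :: "nat \<Rightarrow> 'a::finite"
  shows "measure haar_O {c. \<forall>i<L. c i = a i} = 1 / real CARD('a) ^ L"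
  using measure_haar_O_Collect[of "{..<L}" a] by (simp add: Ball_def)

lemma measure_haar_O_cyl:
  "measure haar_O (cyl (w :: 'a::finite list)) = 1 / real CARD('a) ^ length w"
  by (simp add: cyl_def measure_haar_O_Collect_less)

section \<open>Measure-preserving maps of the valuation ring\<close>

lemma triangular_preimage:
  fixes \<Phi> :: "(nat \<Rightarrow> 'a::finite) \<Rightarrow> (nat \<Rightarrow> 'a)"
  assumes tri: "\<And>j c c'. (\<forall>i<j. c i = c' i) \<Longrightarrow> \<Phi> c j = \<Phi> c' j \<longleftrightarrow> c j = c' j"
  shows "\<exists>b. \<forall>c. (\<forall>j<M. \<Phi> c j = a j) \<longleftrightarrow> (\<forall>j<M. c j = b j)"
proof (induction M)
  case (Suc M)
  then obtain b where b: "\<And>c. (\<forall>j<M. \<Phi> c j = a j) \<longleftrightarrow> (\<forall>j<M. c j = b j)" by auto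
  \<comment> \<open>With the earlier coordinates fixed to \<open>b\<close>, the next one enters
    injectively, hence bijectively because the alphabet is finite; exactly one value solves the next
    equation.\<close>
  have "inj (\<lambda>t. \<Phi> (b(M := t)) M)"
  proof (rule injI)
    fix s t assume "\<Phi> (b(M := s)) M = \<Phi> (b(M := t)) M"
    thus "s = t" using tri[of M "b(M := s)" "b(M := t)"] by simp
  qed
  hence "surj (\<lambda>t. \<Phi> (b(M := t)) M)" by (simp add: finite_UNIV_inj_surj)
  from surjD[OF this, of "a M"] obtain t where t: "\<Phi> (b(M := t)) M = a M" by auto
  have "(\<forall>j<Suc M. \<Phi> c j = a j) \<longleftrightarrow> (\<forall>j<Suc M. c j = (b(M := t)) j)" for c
    using b[of c] tri[of M c "b(M := t)"] t by (auto simp: less_Suc_eq)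
  thus ?case by blast
qed simp

text \<open>A triangular map permutes the cylinders of each fixed length.\<close>

lemma
  fixes \<Phi> :: "(nat \<Rightarrow> 'a::finite) \<Rightarrow> (nat \<Rightarrow> 'a)"
  assumes tri: "\<And>j c c'. (\<forall>i<j. c i = c' i) \<Longrightarrow> \<Phi> c j = \<Phi> c' j \<longleftrightarrow> c j = c' j"
  shows measurable_triangular: "\<Phi> \<in> measurable haar_O haar_O"
    and distr_triangular: "distr haar_O haar_O \<Phi> = haar_O"
proof -
  show m: "\<Phi> \<in> measurable haar_O haar_O"
    by (rule measurable_local[where B = Suc]) (use tri in auto)
  interpret H: prob_space "haar_O :: (nat \<Rightarrow> 'a) measure" by (rule prob_space_haar_O)
  show "distr haar_O haar_O \<Phi> = haar_O"
  proof (rule measure_eqI_cyl)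
    fix w :: "'a list"
    obtain b where b: "\<And>c. (\<forall>j<length w. \<Phi> c j = w ! j) \<longleftrightarrow> (\<forall>j<length w. c j = b j)"
      using triangular_preimage[of \<Phi> "length w" "\<lambda>j. w ! j"] tri by blast
    have "measure (distr haar_O haar_O \<Phi>) (cyl w) = measure haar_O {c. \<forall>j<length w. c j = b j}"
      using b by (simp add: measure_distr m cyl_def[of w] vimage_def cyl_in_sets[of w, unfolded cyl_def])
    thus "measure (distr haar_O haar_O \<Phi>) (cyl w) = measure haar_O (cyl w)"
      by (simp only: measure_haar_O_Collect_less measure_haar_O_cyl)
  qed (auto intro: H.prob_space_distr m prob_space_haar_O)
qed

text \<open>The leading coefficient of a point may sit at any index \<open>k\<close>; invariance
  under shifts carries an almost sure statement about all series over to their tails from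
  \<open>k\<close> on.\<close>

lemma
  shows measurable_shift: "(\<lambda>(c :: nat \<Rightarrow> 'a::finite) i. c (k + i)) \<in> measurable haar_O haar_O"
    and distr_shift: "distr haar_O haar_O (\<lambda>(c :: nat \<Rightarrow> 'a) i. c (k + i)) = haar_O"
proof -
  show m: "(\<lambda>(c :: nat \<Rightarrow> 'a::finite) i. c (k + i)) \<in> measurable haar_O haar_O"
    by (rule measurable_local[where B = "\<lambda>i. Suc (k + i)"]) auto
  interpret H: prob_space "haar_O :: (nat \<Rightarrow> 'a) measure" by (rule prob_space_haar_O)
  show "distr haar_O haar_O (\<lambda>(c :: nat \<Rightarrow> 'a) i. c (k + i)) = haar_O"
  proof (rule measure_eqI_cyl)
    fix w :: "'a list"
    have "(\<lambda>(c :: nat \<Rightarrow> 'a) i. c (k + i)) -` cyl w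
        = {c. \<forall>i\<in>(+) k ` {..<length w}. c i = w ! (i - k)}"
      by (auto simp: cyl_def)
    thus "measure (distr haar_O haar_O (\<lambda>(c :: nat \<Rightarrow> 'a) i. c (k + i))) (cyl w) = measure haar_O (cyl w)"
      using measure_haar_O_Collect[of "(+) k ` {..<length w}" "\<lambda>i. w ! (i - k)"]
      by (simp only: measure_distr[OF m cyl_in_sets] space_haar_O Int_UNIV_right measure_haar_O_cyl
          finite_imageI finite_lessThan card_image inj_on_add card_lessThan)
  qed (auto intro: H.prob_space_distr m prob_space_haar_O)
qed

section \<open>Continuous functions on the valuation ring\<close>

lemma O_top_topspace [simp]: "topspace O_top = UNIV"
  by (simp add: O_top_def)

lemma continuous_map_O_top_coord:
  "continuous_map O_top (discrete_topology UNIV) (\<lambda>c. c i)"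
  unfolding O_top_def by (rule continuous_map_product_projection) simp

lemma openin_O_topE:
  assumes "openin O_top U" "c \<in> U"
  obtains L where "\<And>c'. (\<forall>i<L. c' i = c i) \<Longrightarrow> c' \<in> U"
proof -
  obtain V where V: "finite {i. V i \<noteq> UNIV}" "c \<in> Pi\<^sub>E UNIV V" "Pi\<^sub>E UNIV V \<subseteq> U"
    using assms by (auto simp: O_top_def openin_product_topology_alt)
  obtain L where L: "{i. V i \<noteq> UNIV} \<subseteq> {..<L}"
    using V(1) finite_nat_iff_bounded by blast
  have "c' \<in> U" if "\<forall>i<L. c' i = c i" for c'
  proof -
    have "c' i \<in> V i" for i
      using V(2) L that by (cases "i < L") (auto simp: PiE_iff)
    thus ?thesis using V(3) by auto
  qed
  thus ?thesis by (rule that)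
qed

lemma openin_O_top_local:
  fixes A :: "(nat \<Rightarrow> 'a) set"
  assumes loc: "\<And>c c'. (\<forall>i<L. c i = c' i) \<Longrightarrow> c \<in> A \<Longrightarrow> c' \<in> A"
  shows "openin O_top A"
proof -
  have ball: "openin O_top {c'. \<forall>i<L. c' i = c i}" for c :: "nat \<Rightarrow> 'a"
  proof -
    have "openin O_top {c' \<in> topspace O_top. c' i \<in> {c i}}" for i
      by (rule openin_continuous_map_preimage[OF continuous_map_O_top_coord]) simp
    hence "openin O_top (\<Inter>i\<in>{..<L}. {c' \<in> topspace O_top. c' i \<in> {c i}})" if "L > 0"
      using that by (intro openin_Inter finite_imageI) auto
    moreover have "(\<Inter>i\<in>{..<L}. {c' \<in> topspace O_top. c' i \<in> {c i}}) = {c'. \<forall>i<L. c' i = c i}"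
      by auto
    ultimately show ?thesis
      using openin_topspace[of O_top] by (cases "L = 0") auto
  qed
  have "openin O_top (\<Union>c\<in>A. {c'. \<forall>i<L. c' i = c i})" using ball by blast
  moreover have "(\<Union>c\<in>A. {c'. \<forall>i<L. c' i = c i}) = A"
  proof (intro equalityI subsetI)
    fix c' assume "c' \<in> (\<Union>c\<in>A. {c'. \<forall>i<L. c' i = c i})"
    then obtain c where "c \<in> A" "\<forall>i<L. c i = c' i" by auto
    thus "c' \<in> A" using loc by blast
  qed auto
  ultimately show ?thesis by simp
qed

lemma continuous_map_O_top_local:
  fixes f :: "(nat \<Rightarrow> 'a) \<Rightarrow> 'b :: topological_space"
  assumes loc: "\<And>c c'. (\<forall>i<L. c i = c' i) \<Longrightarrow> f c = f c'"
  shows "continuous_map O_top euclidean f"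
proof -
  have "openin O_top {c. f c \<in> U}" for U
  proof (rule openin_O_top_local[where L = L])
    fix c c' :: "nat \<Rightarrow> 'a" assume "\<forall>i<L. c i = c' i" "c \<in> {c. f c \<in> U}"
    thus "c' \<in> {c. f c \<in> U}" using loc[of c c'] by simp
  qed
  thus ?thesis by (simp add: continuous_map_def)
qed

text \<open>This is Heine-Cantor: finitely many balls cover the space, and the longest of their
  lengths works everywhere. Two points that agree that far lie in a common ball, and the value at
  its centre is within \<open>\<epsilon> / 2\<close> of both values.\<close>

lemma continuous_map_O_top_uniform:
  fixes f :: "(nat \<Rightarrow> 'a::finite) \<Rightarrow> real"
  assumes f: "continuous_map O_top euclideanreal f" and "\<epsilon> > 0"
  obtains L where "\<And>c c'. (\<forall>i<L. c i = c' i) \<Longrightarrow> \<bar>f c - f c'\<bar> \<le> \<epsilon>"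
proof -
  have "compact_space (O_top :: (nat \<Rightarrow> 'a) topology)"
    unfolding O_top_def
    by (simp add: compact_space_product_topology compact_space_discrete_topology)
  have "\<exists>L. \<forall>c'. (\<forall>i<L. c' i = c i) \<longrightarrow> \<bar>f c' - f c\<bar> < \<epsilon> / 2" for c
  proof -
    have "openin O_top {x \<in> topspace O_top. f x \<in> ball (f c) (\<epsilon> / 2)}"
      using f by (rule openin_continuous_map_preimage) simp
    from openin_O_topE[OF this, of c] show ?thesis
      using \<open>\<epsilon> > 0\<close> by (auto simp: dist_real_def abs_minus_commute) metis
  qed
  then obtain L where L: "\<And>c c'. (\<forall>i<L c. c' i = c i) \<Longrightarrow> \<bar>f c' - f c\<bar> < \<epsilon> / 2" by metis
  have "\<forall>U\<in>range (\<lambda>c. {c'. \<forall>i<L c. c' i = c i}). openin O_top U"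
  proof safe
    fix c :: "nat \<Rightarrow> 'a"
    show "openin O_top {c'. \<forall>i<L c. c' i = c i}"
      by (rule openin_O_top_local[where L = "L c"]) auto
  qed
  moreover have "topspace O_top \<subseteq> \<Union>(range (\<lambda>c. {c'. \<forall>i<L c. c' i = c i}))" by auto
  ultimately obtain \<F> where \<F>: "finite \<F>" "\<F> \<subseteq> range (\<lambda>c. {c'. \<forall>i<L c. c' i = c i})"
      "topspace O_top \<subseteq> \<Union>\<F>"
    using \<open>compact_space O_top\<close> unfolding compact_space_alt by meson
  from finite_subset_image[OF \<F>(1,2)] obtain C where C: "finite C"
      "\<F> = (\<lambda>c. {c'. \<forall>i<L c. c' i = c i}) ` C" by auto
  show ?thesis
  proof (rule that)
    fix c c' :: "nat \<Rightarrow> 'a"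
    assume eq: "\<forall>i<Max (insert 0 (L ` C)). c i = c' i"
    obtain b where b: "b \<in> C" "\<forall>i<L b. c i = b i" using \<F>(3) C(2) by auto
    have "L b \<le> Max (insert 0 (L ` C))" using b C by (intro Max_ge) auto
    hence "\<forall>i<L b. c' i = b i" using eq b(2) by auto
    from L[OF this] L[OF b(2)] show "\<bar>f c - f c'\<bar> \<le> \<epsilon>" by linarith
  qed
qed

lemma continuous_map_O_top_approx:
  fixes f :: "(nat \<Rightarrow> 'a::finite) \<Rightarrow> real"
  assumes f: "continuous_map O_top euclideanreal f" and "\<epsilon> > 0"
  obtains W and g :: "'a list \<Rightarrow> real" where "finite W"
    "\<And>c. \<bar>f c - (\<Sum>w\<in>W. g w * indicator (cyl w) c)\<bar> \<le> \<epsilon>"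
proof -
  obtain L where L: "\<And>c c'. (\<forall>i<L. c i = c' i) \<Longrightarrow> \<bar>f c - f c'\<bar> \<le> \<epsilon>"
    using continuous_map_O_top_uniform[OF assms] by blast
  define W where "W = {w :: 'a list. set w \<subseteq> UNIV \<and> length w = L}"
  have W: "finite W" unfolding W_def by (intro finite_lists_length_eq) simp
  show ?thesis
  proof (rule that[OF W])
    fix c
    \<comment> \<open>The coefficient of a disk is the value of \<open>f\<close> at one of its
      points, the one with tail \<open>undefined\<close>. Exactly one word of length
      \<open>L\<close> matches \<open>c\<close>, so the sum collapses to that value.\<close>
    have "(\<Sum>w\<in>W. f (\<lambda>i. if i < L then w ! i else undefined) * indicator (cyl w) c)
        = (\<Sum>w\<in>W. if w = map c [0..<L] then f (\<lambda>i. if i < L then w ! i else undefined) else 0)"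
      by (intro sum.cong) (auto simp: cyl_def W_def indicator_def intro!: nth_equalityI)
    also have "\<dots> = f (\<lambda>i. if i < L then map c [0..<L] ! i else undefined)"
      using W by (simp add: W_def)
    finally show "\<bar>f c - (\<Sum>w\<in>W. f (\<lambda>i. if i < L then w ! i else undefined) * indicator (cyl w) c)\<bar> \<le> \<epsilon>"
      by (simp add: L)
  qed
qed

lemma continuous_map_O_top_bounded:
  fixes f :: "(nat \<Rightarrow> 'a::finite) \<Rightarrow> real"
  assumes f: "continuous_map O_top euclideanreal f"
  obtains B where "\<And>c. \<bar>f c\<bar> \<le> B"
proof -
  obtain W and g :: "'a list \<Rightarrow> real" where W: "finite W"
    "\<And>c. \<bar>f c - (\<Sum>w\<in>W. g w * indicator (cyl w) c)\<bar> \<le> 1"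
    using continuous_map_O_top_approx[OF f, of 1] by auto
  have "\<bar>f c\<bar> \<le> 1 + (\<Sum>w\<in>W. \<bar>g w\<bar>)" for c
  proof -
    have "\<bar>\<Sum>w\<in>W. g w * indicator (cyl w) c\<bar> \<le> (\<Sum>w\<in>W. \<bar>g w\<bar>)"
      by (intro order.trans[OF sum_abs] sum_mono) (auto simp: indicator_def)
    thus ?thesis using W(2)[of c] by linarith
  qed
  thus ?thesis by (rule that)
qed

text \<open>The sigma-algebra of \<open>haar_O\<close> is the product one, so continuity for
  \<open>O_top\<close> has to be converted: \<open>f\<close> is a pointwise limit of step functions
  on disks.\<close>

lemma continuous_map_O_top_measurable:
  fixes f :: "(nat \<Rightarrow> 'a::finite) \<Rightarrow> real"
  assumes f: "continuous_map O_top euclideanreal f"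
  shows "f \<in> borel_measurable haar_O"
proof -
  have "\<exists>h. h \<in> borel_measurable haar_O \<and> (\<forall>c. \<bar>f c - h c\<bar> \<le> 1 / real (Suc n))" for n
  proof -
    obtain W and g :: "'a list \<Rightarrow> real" where W: "finite W"
      "\<And>c. \<bar>f c - (\<Sum>w\<in>W. g w * indicator (cyl w) c)\<bar> \<le> 1 / real (Suc n)"
      using continuous_map_O_top_approx[OF f, of "1 / real (Suc n)"] by auto
    have "(\<lambda>c. \<Sum>w\<in>W. g w * indicator (cyl w) c) \<in> borel_measurable haar_O"
      by measurable
    thus ?thesis using W(2) by blast
  qed
  then obtain h where h: "\<And>n. h n \<in> borel_measurable haar_O"
      "\<And>n c. \<bar>f c - h n c\<bar> \<le> 1 / real (Suc n)" by metis
  have "(\<lambda>n. h n c) \<longlonglongrightarrow> f c" for c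
  proof (rule LIM_zero_cancel, rule Lim_null_comparison)
    show "\<forall>\<^sub>F n in sequentially. norm (h n c - f c) \<le> 1 / real (Suc n)"
      using h(2) by (simp add: abs_minus_commute)
    show "(\<lambda>n. 1 / real (Suc n)) \<longlonglongrightarrow> 0"
      by (rule LIMSEQ_Suc[OF lim_1_over_n])
  qed
  thus ?thesis by (intro borel_measurable_LIMSEQ_real[OF _ h(1)]) auto
qed

text \<open>Weyl's criterion: step functions on disks are uniformly dense in the continuous
  functions. Since there are only countably many disks, almost sure statements can be proved for one
  disk at a time.\<close>

lemma unif_distrI_cyl:
  fixes \<nu> :: "(nat \<Rightarrow> 'a::finite) measure"
  assumes "prob_space \<nu>" and sets: "sets \<nu> = sets haar_O"
    and freq: "\<And>w. (\<lambda>N. (\<Sum>n<N. indicator (cyl w) (s n)) / real N) \<longlonglongrightarrow> measure \<nu> (cyl w)"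
  shows "unif_distr \<nu> s"
  unfolding unif_distr_def
proof (intro allI impI)
  interpret prob_space \<nu> by fact
  note [measurable_cong] = sets
  fix f :: "(nat \<Rightarrow> 'a) \<Rightarrow> real" assume f: "continuous_map O_top euclideanreal f"
  obtain B where B: "\<And>c. \<bar>f c\<bar> \<le> B" using continuous_map_O_top_bounded[OF f] by blast
  have f_meas [measurable]: "f \<in> borel_measurable \<nu>"
    using continuous_map_O_top_measurable[OF f] by (simp cong: measurable_cong_sets add: sets)
  have f_int: "integrable \<nu> f" by (rule integrable_const_bound[where B = B]) (use B in auto)
  have cyl_int: "integrable \<nu> (indicat_real (cyl w))" for w :: "'a list"
    by (rule integrable_const_bound[where B = 1]) (auto simp: indicator_def)
  show "(\<lambda>N. (\<Sum>n<N. f (s n)) / real N) \<longlonglongrightarrow> integral\<^sup>L \<nu> f"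
  proof (rule LIMSEQ_I)
    \<comment> \<open>A quarter of \<open>r\<close> is spent on each of three errors: replacing
      \<open>f\<close> by \<open>h\<close> in the average, doing so in the integral, and the
      convergence for \<open>h\<close>.\<close>
    fix r :: real assume "r > 0"
    obtain W and g :: "'a list \<Rightarrow> real" where W: "finite W"
      "\<And>c. \<bar>f c - (\<Sum>w\<in>W. g w * indicator (cyl w) c)\<bar> \<le> r / 4"
      using continuous_map_O_top_approx[OF f, of "r / 4"] \<open>r > 0\<close> by auto
    define h where "h c = (\<Sum>w\<in>W. g w * indicator (cyl w) c)" for c
    have h_int: "integrable \<nu> h" unfolding h_def using cyl_int by auto
    have "integral\<^sup>L \<nu> h = (\<Sum>w\<in>W. g w * measure \<nu> (cyl w))"
      unfolding h_def using cyl_int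
      by (subst Bochner_Integration.integral_sum) auto
    moreover have "(\<Sum>n<N. h (s n)) / real N = (\<Sum>w\<in>W. g w * ((\<Sum>n<N. indicator (cyl w) (s n)) / real N))" for N
      unfolding h_def by (subst sum.swap)
        (simp only: sum_distrib_left sum_divide_distrib times_divide_eq_right)
    ultimately have "(\<lambda>N. (\<Sum>n<N. h (s n)) / real N) \<longlonglongrightarrow> integral\<^sup>L \<nu> h"
      by (simp only:) (intro tendsto_sum tendsto_mult tendsto_const freq)
    from LIMSEQ_D[OF this, of "r / 4"] obtain N0 where
      N0: "\<And>N. N \<ge> N0 \<Longrightarrow> \<bar>(\<Sum>n<N. h (s n)) / real N - integral\<^sup>L \<nu> h\<bar> < r / 4"
      using \<open>r > 0\<close> by auto
    have int: "\<bar>integral\<^sup>L \<nu> f - integral\<^sup>L \<nu> h\<bar> \<le> r / 4"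
    proof -
      have "\<bar>integral\<^sup>L \<nu> (\<lambda>c. f c - h c)\<bar> \<le> integral\<^sup>L \<nu> (\<lambda>c. \<bar>f c - h c\<bar>)"
        by (rule integral_abs_bound)
      also have "\<dots> \<le> integral\<^sup>L \<nu> (\<lambda>c. r / 4)"
        using f_int h_int W(2)[folded h_def] by (intro integral_mono) auto
      finally show ?thesis using f_int h_int by (simp add: prob_space)
    qed
    have avg: "\<bar>(\<Sum>n<N. f (s n)) / real N - (\<Sum>n<N. h (s n)) / real N\<bar> \<le> r / 4" for N
    proof -
      have "\<bar>(\<Sum>n<N. f (s n) - h (s n))\<bar> \<le> (\<Sum>n<N. r / 4)"
        using W(2) by (intro order.trans[OF sum_abs] sum_mono) (simp add: h_def)
      hence "\<bar>(\<Sum>n<N. f (s n) - h (s n)) / real N\<bar> \<le> r / 4"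
        using \<open>r > 0\<close> by (cases "N = 0") (simp_all add: field_simps)
      thus ?thesis by (simp add: sum_subtractf diff_divide_distrib)
    qed
    have "norm ((\<Sum>n<N. f (s n)) / real N - integral\<^sup>L \<nu> f) < r" if "N \<ge> N0" for N
      unfolding real_norm_def using N0[OF that] int avg[of N] \<open>r > 0\<close> by linarith
    thus "\<exists>N0. \<forall>N\<ge>N0. norm ((\<Sum>n<N. f (s n)) / real N - integral\<^sup>L \<nu> f) < r" by blast
  qed
qed

section \<open>Coefficients of powers\<close>

lemma prime_CHAR_finite_field: "prime CHAR('a::{finite,field})"
  by (rule prime_CHAR_semidom) (simp add: finite_imp_CHAR_pos)

lemma fls_shift_power:
  fixes f :: "'a::comm_semiring_1 fls"
  shows "fls_shift m f ^ n = fls_shift (int n * m) (f ^ n)"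
  by (induction n) (auto simp: fls_times_both_shifted_simp algebra_simps)

text \<open>Each of the \<open>n\<close> factors is shifted by \<open>s\<close>, so the integral
  part of the power is the tail of a power of a power series that starts at index
  \<open>s * n\<close>.\<close>

lemma nth_lift_O_power:
  fixes c :: "nat \<Rightarrow> 'a::{finite,field}"
  shows "fls_nth (lift_O s c ^ n) (int i) = fps_nth (Abs_fps c ^ n) (i + s * n)"
proof -
  have eq: "int i + int n * int s = int (i + s * n)" by simp
  show ?thesis
    unfolding lift_O_def fls_shift_power fls_shift_nth eq
    by (simp flip: fps_to_fls_power del: of_nat_add of_nat_mult)
qed

lemma lift_O_surj:
  fixes x :: "'a::zero fls"
  obtains s c where "x = lift_O s c"
proof -
  define s where "s = nat (- fls_subdegree x)"
  have "x = lift_O s (\<lambda>i. fls_nth x (int i - int s))"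
    by (intro fls_eqI) (auto simp: lift_O_def s_def)
  thus ?thesis by (rule that)
qed

text \<open>The freshman's dream concerns finite sums, so \<open>f\<close> is cut after degree
  \<open>n\<close>. The remainder is divisible by \<open>fps_X ^ Suc n\<close>, and its
  \<open>P\<close>-th power starts beyond degree \<open>n\<close>.\<close>

lemma fps_power_prime_power_nth:
  fixes f :: "'a::comm_ring_1 fps"
  assumes p: "prime CHAR('a)" and P: "P = CHAR('a) ^ k"
  shows "fps_nth (f ^ P) n = (if P dvd n then fps_nth f (n div P) ^ P else 0)"
proof -
  have Ppos: "P > 0" using p by (simp add: P prime_gt_0_nat)
  define g where "g = (\<Sum>i\<le>n. fps_const (fps_nth f i) * fps_X ^ i)"
  define h where "h = fps_shift (Suc n) f"
  have f: "f = g + fps_X ^ Suc n * h"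
  proof (rule fps_ext)
    fix i
    have "fps_nth g i = (\<Sum>j\<le>n. if i = j then fps_nth f j else 0)"
      unfolding g_def fps_sum_nth by (intro sum.cong) (auto simp: fps_X_power_nth)
    thus "fps_nth f i = fps_nth (g + fps_X ^ Suc n * h) i"
      unfolding fps_add_nth fps_X_power_mult_nth by (simp add: h_def)
  qed
  have "f ^ P = g ^ P + (fps_X ^ Suc n * h) ^ P"
    unfolding f by (rule freshmans_dream') (use p P in simp_all)
  also have "g ^ P = (\<Sum>i\<le>n. (fps_const (fps_nth f i) * fps_X ^ i) ^ P)"
    unfolding g_def by (rule freshmans_dream_sum') (use p P in simp_all)
  also have "\<dots> = (\<Sum>i\<le>n. fps_const (fps_nth f i ^ P) * fps_X ^ (i * P))"
    by (simp add: power_mult_distrib fps_const_power power_mult)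
  finally have "fps_nth (f ^ P) n = (\<Sum>i\<le>n. if n = i * P then fps_nth f i ^ P else 0)
      + fps_nth ((fps_X ^ Suc n * h) ^ P) n"
    by (simp only: fps_add_nth fps_sum_nth)
       (intro arg_cong2[where f = "(+)"] sum.cong refl, simp add: fps_X_power_nth)
  also have "fps_nth ((fps_X ^ Suc n * h) ^ P) n = 0"
  proof -
    have "n < Suc n * P" using Ppos by (cases P) auto
    thus ?thesis by (simp only: power_mult_distrib power_mult[symmetric] fps_X_power_mult_nth if_True)
  qed
  also have "(\<Sum>i\<le>n. if n = i * P then fps_nth f i ^ P else 0)
      = (if P dvd n then fps_nth f (n div P) ^ P else 0)"
  proof (cases "P dvd n")
    case True
    hence "(\<Sum>i\<le>n. if n = i * P then fps_nth f i ^ P else 0)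
        = (\<Sum>i\<le>n. if n div P = i then fps_nth f i ^ P else 0)"
      using Ppos by (intro sum.cong refl) auto
    thus ?thesis using True by simp
  next
    case False
    thus ?thesis by (intro trans[OF sum.neutral]) auto
  qed
  finally show ?thesis by simp
qed

text \<open>The offset \<open>P * (s * n)\<close> is itself a multiple of \<open>P\<close>, so
  spreading the indices by \<open>P\<close> commutes with dropping the polar part.\<close>

lemma int_part_lift_O_power_prime_power:
  fixes c :: "nat \<Rightarrow> 'a::{finite,field}" and k :: nat
  defines "P \<equiv> CHAR('a) ^ k"
  shows "int_part (lift_O s c ^ (P * n)) =
    (\<lambda>i. if P dvd i then int_part (lift_O s c ^ n) (i div P) ^ P else 0)"
proof
  fix i
  have P: "P > 0" by (simp add: P_def prime_gt_0_nat[OF prime_CHAR_finite_field])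
  have "int_part (lift_O s c ^ (P * n)) i = fps_nth ((Abs_fps c ^ n) ^ P) (i + P * (s * n))"
    by (simp add: int_part_def nth_lift_O_power mult_ac flip: power_mult)
  also have "\<dots> = (if P dvd i then fps_nth (Abs_fps c ^ n) (i div P + s * n) ^ P else 0)"
    using P by (subst fps_power_prime_power_nth[where k = k])
       (auto simp: P_def prime_CHAR_finite_field dvd_add_left_iff)
  finally show "int_part (lift_O s c ^ (P * n)) i =
      (if P dvd i then int_part (lift_O s c ^ n) (i div P) ^ P else 0)"
    by (simp add: int_part_def nth_lift_O_power)
qed

lemma inj_power_prime_power:
  "inj (\<lambda>x::'a::{finite,field}. x ^ (CHAR('a) ^ k))"
proof (rule injI)
  fix x y :: 'a assume "x ^ (CHAR('a) ^ k) = y ^ (CHAR('a) ^ k)"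
  moreover have "((x - y) + y) ^ (CHAR('a) ^ k) = (x - y) ^ (CHAR('a) ^ k) + y ^ (CHAR('a) ^ k)"
    by (rule freshmans_dream') (simp_all add: prime_CHAR_finite_field)
  ultimately show "x = y" by simp
qed

text \<open>In the factorization of \<open>f ^ n - g ^ n\<close> the factor \<open>f - g\<close>
  vanishes below degree \<open>j\<close>, so its coefficient at \<open>j\<close> meets only constant
  terms of the other factor. The constant terms of \<open>f\<close> and \<open>g\<close> agree
  because \<open>j > 0\<close>; they add up to n f_0^(n-1), which is nonzero as the characteristic
  does not divide \<open>n\<close>.\<close>

lemma fps_power_nth_eq_iff:
  fixes f g :: "'a::idom fps"
  assumes agree: "\<And>i. i < j \<Longrightarrow> fps_nth f i = fps_nth g i"
    and j: "j > 0" and f0: "fps_nth f 0 \<noteq> 0" and n: "\<not> CHAR('a) dvd n"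
  shows "fps_nth (f ^ n) j = fps_nth (g ^ n) j \<longleftrightarrow> fps_nth f j = fps_nth g j"
proof -
  define v where "v = fps_shift j (f - g)"
  have v: "f - g = fps_X ^ j * v"
    by (intro fps_ext) (auto simp: v_def fps_X_power_mult_nth agree)
  from n obtain m where m: "n = Suc m" by (cases n) auto
  have "fps_nth (f ^ n - g ^ n) j = fps_nth (fps_X ^ j * (v * (\<Sum>p<Suc m. f ^ p * g ^ (m - p)))) j"
    unfolding m by (simp only: diff_power_eq_sum v mult.assoc)
  also have "\<dots> = fps_nth v 0 * (\<Sum>p<Suc m. fps_nth f 0 ^ p * fps_nth g 0 ^ (m - p))"
    by (simp add: fps_X_power_mult_nth fps_sum_nth fps_power_zeroth_eq_one fps_power_zeroth
        del: sum.lessThan_Suc)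
  also have "(\<Sum>p<Suc m. fps_nth f 0 ^ p * fps_nth g 0 ^ (m - p)) = (\<Sum>p<Suc m. fps_nth f 0 ^ m)"
    using agree[OF j] by (intro sum.cong refl) (auto simp flip: power_add)
  also have "\<dots> = of_nat n * fps_nth f 0 ^ m" by (simp add: m)
  finally have "fps_nth (f ^ n) j - fps_nth (g ^ n) j
      = (fps_nth f j - fps_nth g j) * (of_nat n * fps_nth f 0 ^ m)"
    by (simp add: v_def)
  moreover have "of_nat n * fps_nth f 0 ^ m \<noteq> 0"
    using n f0 by (simp add: of_nat_eq_0_iff_char_dvd)
  ultimately show ?thesis by (metis eq_iff_diff_eq_0 mult_eq_0_iff)
qed

text \<open>Every leading zero cancels one unit of the shift \<open>s\<close>. If
  \<open>c i0\<close> is nonzero, what remains of the shift is the order of the pole, and the series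
  left over has nonzero constant term.\<close>

lemma int_part_lift_O_power_shift:
  fixes c :: "nat \<Rightarrow> 'a::{finite,field}"
  assumes "\<And>i. i < i0 \<Longrightarrow> c i = 0" and s: "s = i0 + d"
  shows "int_part (lift_O s c ^ n) i = fps_nth (Abs_fps (\<lambda>j. c (i0 + j)) ^ n) (i + d * n)"
proof -
  have "Abs_fps c = fps_X ^ i0 * Abs_fps (\<lambda>j. c (i0 + j))"
    by (intro fps_ext) (auto simp: fps_X_power_mult_nth assms)
  hence "Abs_fps c ^ n = fps_X ^ (i0 * n) * Abs_fps (\<lambda>j. c (i0 + j)) ^ n"
    by (simp add: power_mult_distrib power_mult)
  thus ?thesis
    by (simp add: int_part_def nth_lift_O_power fps_X_power_mult_nth s algebra_simps)
qed

lemma abs_p_gt_1_iff: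
  fixes x :: "'a::{finite,field} fls"
  shows "abs_p x > 1 \<longleftrightarrow> fls_subdegree x < 0"
proof -
  have "card {0, 1 :: 'a} \<le> CARD('a)" by (rule card_mono) auto
  hence "real CARD('a) > 1" by simp
  thus ?thesis
    using powr_less_cancel_iff[of "real CARD('a)" 0 "- real_of_int (fls_subdegree x)"]
    by (auto simp: abs_p_def)
qed

lemma abs_p_lift_O_gt_1E:
  fixes c :: "nat \<Rightarrow> 'a::{finite,field}"
  assumes "abs_p (lift_O s c) > 1"
  obtains i0 d where "\<And>i. i < i0 \<Longrightarrow> c i = 0" "c i0 \<noteq> 0" "d > 0" "s = i0 + d"
proof -
  define k where "k = fls_subdegree (lift_O s c)"
  have k: "k < 0" using assms by (simp add: k_def abs_p_gt_1_iff)
  have nth: "fls_nth (lift_O s c) i = (if i + int s < 0 then 0 else c (nat (i + int s)))" for i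
    by (simp add: lift_O_def)
  have "lift_O s c \<noteq> 0" using assms by (auto simp: abs_p_def)
  hence nz: "fls_nth (lift_O s c) k \<noteq> 0" by (simp add: k_def)
  have sk: "k + int s \<ge> 0" using nz by (auto simp: nth split: if_splits)
  show ?thesis
  proof (rule that)
    show "c i = 0" if "i < nat (k + int s)" for i
    proof -
      have "fls_nth (lift_O s c) (int i - int s) = 0"
        unfolding k_def using that sk by (intro fls_eq0_below_subdegree) (auto simp: k_def)
      thus ?thesis by (simp add: nth)
    qed
    show "c (nat (k + int s)) \<noteq> 0" using nz sk by (auto simp: nth)
    show "nat (- k) > 0" "s = nat (k + int s) + nat (- k)" using k sk by auto
  qed
qed

section \<open>Exponents of fixed p-adic valuation\<close>

text \<open>Prescribing the exponent separately for each coordinate lets one triangular map read off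
  windows of several powers of \<open>u\<close> at once, so that their joint law is that of plain
  coordinates. The exponent \<open>0\<close> leaves a coordinate unchanged.\<close>

definition power_map :: "(nat \<Rightarrow> nat) \<Rightarrow> (nat \<Rightarrow> 'a::{finite,field}) \<Rightarrow> (nat \<Rightarrow> 'a)" where
  "power_map \<kappa> u j = (if u 0 \<noteq> 0 \<and> \<not> CHAR('a) dvd \<kappa> j \<and> j > 0
     then fps_nth (Abs_fps u ^ \<kappa> j) j else u j)"

text \<open>Coordinate 0 is never changed, so for positive \<open>j\<close> both arguments fall
  under the same case of \<open>power_map\<close>.\<close>

lemma power_map_triangular:
  fixes u u' :: "nat \<Rightarrow> 'a::{finite,field}"
  assumes "\<forall>i<j. u i = u' i"
  shows "power_map \<kappa> u j = power_map \<kappa> u' j \<longleftrightarrow> u j = u' j"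
proof (cases "j = 0")
  case False
  hence "u 0 = u' 0" using assms by simp
  thus ?thesis
    using assms False fps_power_nth_eq_iff[of j "Abs_fps u" "Abs_fps u'" "\<kappa> j"]
    by (auto simp: power_map_def)
qed (simp add: power_map_def)

lemma
  fixes \<kappa> :: "nat \<Rightarrow> nat" and a :: "nat \<Rightarrow> 'a::{finite,field}"
  assumes J: "finite J"
  shows power_map_Collect_in_sets: "{u. \<forall>j\<in>J. power_map \<kappa> u j = a j} \<in> sets haar_O"
    and measure_power_map_Collect:
      "measure haar_O {u. \<forall>j\<in>J. power_map \<kappa> u j = a j} = 1 / real CARD('a) ^ card J"
proof -
  have m: "power_map \<kappa> \<in> measurable (haar_O :: (nat \<Rightarrow> 'a) measure) haar_O"
    by (rule measurable_triangular) (rule power_map_triangular)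
  obtain B where "J \<subseteq> {..<B}" using J finite_nat_iff_bounded by blast
  hence S: "{v. \<forall>j\<in>J. v j = a j} \<in> sets haar_O"
    by (intro local_in_sets[where M = B]) auto
  have eq: "{u. \<forall>j\<in>J. power_map \<kappa> u j = a j} = power_map \<kappa> -` {v. \<forall>j\<in>J. v j = a j} \<inter> space haar_O"
    by auto
  show "{u. \<forall>j\<in>J. power_map \<kappa> u j = a j} \<in> sets haar_O"
    unfolding eq using m S by (rule measurable_sets)
  have "measure haar_O {u. \<forall>j\<in>J. power_map \<kappa> u j = a j}
      = measure (distr haar_O haar_O (power_map \<kappa>)) {v. \<forall>j\<in>J. v j = a j}"
    unfolding eq by (rule measure_distr[OF m S, symmetric])
  also have "distr haar_O haar_O (power_map \<kappa>) = (haar_O :: (nat \<Rightarrow> 'a) measure)"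
    by (rule distr_triangular) (rule power_map_triangular)
  finally show "measure haar_O {u. \<forall>j\<in>J. power_map \<kappa> u j = a j} = 1 / real CARD('a) ^ card J"
    using measure_haar_O_Collect[OF J, of a] by simp
qed

lemma AE_window_frequency:
  fixes e :: "nat \<Rightarrow> nat" and w :: "'a::{finite,field} list"
  assumes e: "strict_mono e" and cop: "\<And>n. \<not> CHAR('a) dvd e n" and d: "d > 0"
  shows "AE u in haar_O. u 0 \<noteq> 0 \<longrightarrow>
    (\<lambda>N. (\<Sum>n<N. indicator (cyl w) (\<lambda>i. fps_nth (Abs_fps u ^ e n) (i + d * e n))) / real N)
      \<longlonglongrightarrow> 1 / real CARD('a) ^ length w"
proof -
  interpret prob_space "haar_O :: (nat \<Rightarrow> 'a) measure" by (rule prob_space_haar_O)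
  define L where "L = length w"
  define W where "W n = {d * e n..<d * e n + L}" for n
  \<comment> \<open>Using \<open>power_map\<close> instead of the power itself gives these events
    their exact probability without conditioning on \<open>u 0\<close>; the two agree where
    \<open>u 0\<close> is nonzero.\<close>
  define A where "A n = {u. \<forall>j\<in>W n. power_map (\<lambda>_. e n) u j = w ! (j - d * e n)}" for n
  have fin: "finite (W n)" and card: "card (W n) = L" for n by (simp_all add: W_def)
  have "AE u in haar_O. (\<lambda>N. (\<Sum>n<N. indicator (A n) u) / real N) \<longlonglongrightarrow> 1 / real CARD('a) ^ L"
  proof (rule AE_frequency_tendsto)
    show "A n \<in> sets haar_O" for n
      unfolding A_def by (intro power_map_Collect_in_sets fin)
    show "measure haar_O (A n) = 1 / real CARD('a) ^ L" for n
      unfolding A_def by (simp only: measure_power_map_Collect fin card)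
    fix n m assume nm: "n + L \<le> m"
    \<comment> \<open>A strictly increasing sequence of integers gains at least 1 at each step, so
      \<open>L\<close> steps separate the exponents by \<open>L\<close> and, as \<open>d\<close> is
      positive, make the windows disjoint.\<close>
    have "e n + L \<le> e m"
    proof -
      have "e n + k \<le> e (n + k)" for k
        by (induction k) (use e in \<open>auto simp: strict_mono_Suc_iff Suc_le_eq intro: le_less_trans\<close>)
      from this[of L] show ?thesis
        using strict_mono_mono[OF e] nm by (meson monoD order.trans)
    qed
    hence "d * (e n + L) \<le> d * e m" by simp
    moreover have "L \<le> d * L" using d by simp
    ultimately have "d * e n + L \<le> d * e m" unfolding distrib_left by linarith
    hence disj: "W n \<inter> W m = {}" by (auto simp: W_def)
    \<comment> \<open>Disjointness lets one exponent function serve both windows: the intersection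
      of the two events prescribes \<open>L + L\<close> coordinates of a single triangular
      image.\<close>
    define \<kappa> where "\<kappa> j = (if j \<in> W n then e n else e m)" for j
    define a where "a j = (if j \<in> W n then w ! (j - d * e n) else w ! (j - d * e m))" for j
    have n: "power_map \<kappa> u j = power_map (\<lambda>_. e n) u j" "a j = w ! (j - d * e n)"
      if "j \<in> W n" for u j
      using that by (simp_all add: power_map_def \<kappa>_def a_def)
    have m: "power_map \<kappa> u j = power_map (\<lambda>_. e m) u j" "a j = w ! (j - d * e m)"
      if "j \<in> W m" for u j
    proof -
      have "j \<notin> W n" using that disj by blast
      thus "power_map \<kappa> u j = power_map (\<lambda>_. e m) u j" "a j = w ! (j - d * e m)"
        by (simp_all add: power_map_def \<kappa>_def a_def)
    qed
    have "A n \<inter> A m = {u. \<forall>j\<in>W n \<union> W m. power_map \<kappa> u j = a j}"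
      by (simp add: A_def ball_Un n m Collect_conj_eq cong: ball_cong)
    also have "measure haar_O \<dots> = 1 / real CARD('a) ^ card (W n \<union> W m)"
      by (rule measure_power_map_Collect) (use fin in auto)
    also have "card (W n \<union> W m) = L + L"
      using disj fin card by (simp add: card_Un_disjoint)
    finally show "measure haar_O (A n \<inter> A m) = 1 / real CARD('a) ^ L * (1 / real CARD('a) ^ L)"
      by (simp add: power_add)
  qed
  moreover have "indicat_real (A n) u = indicat_real (cyl w) (\<lambda>i. fps_nth (Abs_fps u ^ e n) (i + d * e n))"
    if "u 0 \<noteq> 0" for n u
  proof -
    \<comment> \<open>The window has to avoid coordinate 0, which \<open>power_map\<close> leaves
      unchanged.\<close>
    have "e n > 0" using cop[of n] by (cases "e n") auto
    hence pos: "i + d * e n > 0" for i using d by simp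
    have "u \<in> A n \<longleftrightarrow> (\<forall>i<L. power_map (\<lambda>_. e n) u (i + d * e n) = w ! i)"
    proof -
      have "W n = (\<lambda>i. i + d * e n) ` {..<L}"
        by (simp add: W_def lessThan_atLeast0 image_add_atLeastLessThan' add.commute)
      thus ?thesis by (auto simp: A_def)
    qed
    also have "\<dots> \<longleftrightarrow> (\<lambda>i. fps_nth (Abs_fps u ^ e n) (i + d * e n)) \<in> cyl w"
      using pos that cop[of n] by (simp add: power_map_def cyl_def L_def)
    finally show ?thesis by (simp add: indicator_def)
  qed
  ultimately show ?thesis by (auto simp: L_def elim!: eventually_mono)
qed

lemma haar_AE_unif_distr_haar_O:
  fixes e :: "nat \<Rightarrow> nat"
  assumes e: "strict_mono e" and cop: "\<And>n. \<not> CHAR('a) dvd e n"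
  shows "haar_AE (\<lambda>x :: 'a::{finite,field} fls. abs_p x > 1 \<longrightarrow>
           unif_distr haar_O (\<lambda>j. int_part (x ^ e j)))"
  unfolding haar_AE_def
proof
  fix s
  \<comment> \<open>The order of the pole and the leading index are known only once the point is
    chosen. Hence \<open>G\<close> quantifies over all \<open>d\<close> and \<open>w\<close>, and is
    then required of all shifts \<open>k\<close>; the ranges are countable, so the exceptional set
    stays null.\<close>
  define G where "G u \<longleftrightarrow> (\<forall>d w. d > 0 \<longrightarrow> u 0 \<noteq> 0 \<longrightarrow>
    (\<lambda>N. (\<Sum>n<N. indicator (cyl w) (\<lambda>i. fps_nth (Abs_fps u ^ e n) (i + d * e n))) / real N)
      \<longlonglongrightarrow> 1 / real CARD('a) ^ length w)" for u :: "nat \<Rightarrow> 'a"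
  have "AE u in haar_O. G u"
    unfolding G_def AE_all_countable
  proof (intro allI)
    fix d :: nat and w :: "'a list"
    show "AE u in haar_O. d > 0 \<longrightarrow> u 0 \<noteq> 0 \<longrightarrow>
      (\<lambda>N. (\<Sum>n<N. indicator (cyl w) (\<lambda>i. fps_nth (Abs_fps u ^ e n) (i + d * e n))) / real N)
        \<longlonglongrightarrow> 1 / real CARD('a) ^ length w"
      using AE_window_frequency[OF e cop, of d w] by (cases "d > 0") simp_all
  qed
  hence "AE c in haar_O. G (\<lambda>i. c (k + i))" for k
    by (intro AE_distrD[OF measurable_shift]) (simp only: distr_shift)
  hence "AE c in haar_O. \<forall>k. G (\<lambda>i. c (k + i))" by (simp add: AE_all_countable)
  thus "AE c in haar_O. abs_p (lift_O s c :: 'a fls) > 1 \<longrightarrow>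
      unif_distr haar_O (\<lambda>j. int_part (lift_O s c ^ e j))"
  proof (rule eventually_mono, intro impI)
    fix c :: "nat \<Rightarrow> 'a"
    assume G: "\<forall>k. G (\<lambda>i. c (k + i))" and "abs_p (lift_O s c) > 1"
    then obtain i0 d where *: "\<And>i. i < i0 \<Longrightarrow> c i = 0" "c i0 \<noteq> 0" "d > 0" "s = i0 + d"
      by (elim abs_p_lift_O_gt_1E) blast
    have ip: "int_part (lift_O s c ^ n) = (\<lambda>i. fps_nth (Abs_fps (\<lambda>j. c (i0 + j)) ^ n) (i + d * n))" for n
      using int_part_lift_O_power_shift[of i0 c s d, OF *(1) *(4)] by blast
    show "unif_distr haar_O (\<lambda>j. int_part (lift_O s c ^ e j))"
      unfolding ip
    proof (rule unif_distrI_cyl[OF prob_space_haar_O refl])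
      fix w :: "'a list"
      show "(\<lambda>N. (\<Sum>n<N. indicator (cyl w)
          (\<lambda>i. fps_nth (Abs_fps (\<lambda>j. c (i0 + j)) ^ e n) (i + d * e n))) / real N)
        \<longlonglongrightarrow> measure haar_O (cyl w)"
        using G[rule_format, of i0] *(2,3) by (simp add: G_def measure_haar_O_cyl)
    qed
  qed
qed

section \<open>The p^k-th power map on the valuation ring, in coefficients\<close>

definition frob_map :: "nat \<Rightarrow> (nat \<Rightarrow> 'a::{finite,field}) \<Rightarrow> (nat \<Rightarrow> 'a)" where
  "frob_map k c i = (if CHAR('a) ^ k dvd i then c (i div CHAR('a) ^ k) ^ (CHAR('a) ^ k) else 0)"

lemma continuous_map_frob_map: "continuous_map O_top O_top (frob_map k)"
proof -
  have "continuous_map O_top (discrete_topology UNIV) (\<lambda>c :: nat \<Rightarrow> 'a::{finite,field}. frob_map k c i)" for i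
  proof (cases "CHAR('a) ^ k dvd i")
    case True
    have "continuous_map O_top (discrete_topology UNIV)
        ((\<lambda>x. x ^ (CHAR('a) ^ k)) \<circ> (\<lambda>c :: nat \<Rightarrow> 'a. c (i div CHAR('a) ^ k)))"
      by (rule continuous_map_compose[OF continuous_map_O_top_coord]) simp
    thus ?thesis using True by (simp add: frob_map_def o_def)
  qed (simp add: frob_map_def)
  thus ?thesis unfolding O_top_def[of, where 'a = 'a] by (simp add: continuous_map_componentwise_UNIV)
qed

lemma measurable_frob_map: "frob_map k \<in> measurable haar_O haar_O"
  by (rule measurable_local[where B = "\<lambda>i. Suc (i div CHAR('a) ^ k)"]) (auto simp: frob_map_def)

text \<open>The p^k-th power permutes the finite field, so independent uniform coordinates stay so
  after being moved to the multiples of p^k. A disk asking for a nonzero entry elsewhere has empty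
  preimage, which matches a zero factor of the product.\<close>

lemma distr_frob_map:
  "distr haar_O haar_O (frob_map k) = (mu_k k :: (nat \<Rightarrow> 'a::{finite,field}) measure)"
proof (rule measure_eqI_cyl)
  fix w :: "'a list"
  define P where "P = CHAR('a) ^ k"
  have P: "P > 0" by (simp add: P_def prime_gt_0_nat[OF prime_CHAR_finite_field])
  define J where "J = {..<length w}"
  interpret product_prob_space "\<lambda>i::nat. if P dvd i then unif else measure_pmf (return_pmf (0::'a))" UNIV
    by (intro product_prob_spaceI) (simp add: prob_space_unif prob_space_measure_pmf)
  interpret Q: prob_space "mu_k k :: (nat \<Rightarrow> 'a) measure" by (rule prob_space_mu_k)
  have "emeasure (mu_k k) (cyl w)
      = (\<Prod>i\<in>J. emeasure (if P dvd i then unif else measure_pmf (return_pmf (0::'a))) {w ! i})"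
    using emeasure_PiM_Collect[of J "\<lambda>i. {w ! i}"]
    by (simp add: mu_k_def P_def J_def space_PiM PiE_UNIV_domain cyl_def Ball_def if_distrib cong: if_cong)
  also have "\<dots> = (\<Prod>i\<in>J. ennreal (if P dvd i then 1 / real CARD('a) else if w ! i = 0 then 1 else 0))"
    by (intro prod.cong) (auto simp: unif_def emeasure_pmf_single indicator_def)
  also have "\<dots> = ennreal (\<Prod>i\<in>J. if P dvd i then 1 / real CARD('a) else if w ! i = 0 then 1 else 0)"
    by (intro prod_ennreal) auto
  finally have mu: "measure (mu_k k) (cyl w)
      = (\<Prod>i\<in>J. if P dvd i then 1 / real CARD('a) else if w ! i = 0 then 1 else 0)"
    by (simp add: Q.emeasure_eq_measure prod_nonneg)
  have "surj (\<lambda>x::'a. x ^ P)"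
    using inj_power_prime_power[where 'a = 'a, of k] by (simp add: P_def finite_UNIV_inj_surj)
  hence "\<forall>y::'a. \<exists>x. x ^ P = y" unfolding surj_def by metis
  then obtain g where g: "\<And>y::'a. g y ^ P = y" by metis
  have g_iff: "x ^ P = y \<longleftrightarrow> x = g y" for x y :: 'a
    using g inj_power_prime_power[where 'a = 'a, of k] by (auto simp: inj_def P_def)
  have "measure (distr haar_O haar_O (frob_map k)) (cyl w) = measure haar_O {c. frob_map k c \<in> cyl w}"
    by (simp add: measure_distr[OF measurable_frob_map cyl_in_sets] vimage_def)
  also have "\<dots> = (\<Prod>i\<in>J. if P dvd i then 1 / real CARD('a) else if w ! i = 0 then 1 else 0)"
  proof (cases "\<forall>i\<in>J. \<not> P dvd i \<longrightarrow> w ! i = 0")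
    case True
    define K where "K = (\<lambda>i. i div P) ` {i\<in>J. P dvd i}"
    have "{c. frob_map k c \<in> cyl w} = {c. \<forall>i\<in>K. c i = g (w ! (i * P))}"
      using True by (auto simp: frob_map_def cyl_def g_iff K_def J_def simp flip: P_def)
    moreover have "card K = card {i\<in>J. P dvd i}"
      unfolding K_def by (intro card_image inj_onI) (auto elim!: dvdE simp: P)
    moreover have "(\<Prod>i\<in>J. if P dvd i then 1 / real CARD('a) else if w ! i = 0 then 1 else 0)
        = (\<Prod>i\<in>J. if P dvd i then 1 / real CARD('a) else 1)"
      using True by (intro prod.cong) auto
    moreover have "\<dots> = (1 / real CARD('a)) ^ card {i\<in>J. P dvd i}"
      by (simp add: J_def flip: prod.inter_filter)
    ultimately show ?thesis
      using measure_haar_O_Collect[of K "\<lambda>i. g (w ! (i * P))"]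
      by (simp add: K_def J_def power_one_over)
  next
    case False
    then obtain i where i: "i \<in> J" "\<not> P dvd i" "w ! i \<noteq> 0" by auto
    hence "{c. frob_map k c \<in> cyl w} = {}"
      by (auto simp: frob_map_def cyl_def J_def simp flip: P_def)
    moreover have "(\<Prod>i\<in>J. if P dvd i then 1 / real CARD('a) else if w ! i = 0 then 1 else 0) = 0"
      using i by (intro prod_zero) (auto simp: J_def)
    ultimately show ?thesis by simp
  qed
  finally show "measure (distr haar_O haar_O (frob_map k)) (cyl w) = measure (mu_k k) (cyl w)"
    by (simp only: mu)
qed (auto intro: prob_space.prob_space_distr prob_space_haar_O measurable_frob_map prob_space_mu_k simp: sets_mu_k)

text \<open>A test function composed with a continuous map is again a test function, so weak
  convergence passes to image measures.\<close>

lemma unif_distr_frob_map: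
  fixes t :: "nat \<Rightarrow> nat \<Rightarrow> 'a::{finite,field}"
  assumes "unif_distr haar_O t"
  shows "unif_distr (mu_k k) (\<lambda>j. frob_map k (t j))"
  unfolding unif_distr_def
proof (intro allI impI)
  fix f :: "(nat \<Rightarrow> 'a) \<Rightarrow> real" assume f: "continuous_map O_top euclideanreal f"
  have "continuous_map O_top euclideanreal (f \<circ> frob_map k)"
    by (rule continuous_map_compose[OF continuous_map_frob_map f])
  hence "(\<lambda>N. (\<Sum>n<N. f (frob_map k (t n))) / real N) \<longlonglongrightarrow> (LINT c|haar_O. f (frob_map k c))"
    using assms[unfolded unif_distr_def, rule_format, of "f \<circ> frob_map k"] unfolding o_def by blast
  also have "(LINT c|haar_O. f (frob_map k c)) = integral\<^sup>L (mu_k k) f"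
    by (simp add: integral_distr[OF measurable_frob_map continuous_map_O_top_measurable[OF f]]
        flip: distr_frob_map)
  finally show "(\<lambda>N. (\<Sum>n<N. f (frob_map k (t n))) / real N) \<longlonglongrightarrow> integral\<^sup>L (mu_k k) f" .
qed

text \<open>Dividing the exponents by \<open>P\<close> leaves an increasing sequence of exponents
  prime to the characteristic, and the \<open>P\<close>-th power acts on integral parts as
  \<open>frob_map\<close>.\<close>

lemma haar_AE_unif_distr_mu_k:
  fixes e :: "nat \<Rightarrow> nat"
  assumes e: "strict_mono e" and dvd: "\<And>n. CHAR('a) ^ k dvd e n" "\<And>n. \<not> CHAR('a) ^ Suc k dvd e n"
  shows "haar_AE (\<lambda>x :: 'a::{finite,field} fls. abs_p x > 1 \<longrightarrow>
           unif_distr (mu_k k) (\<lambda>j. int_part (x ^ e j)))"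
proof -
  define P where "P = CHAR('a) ^ k"
  define e' where "e' n = e n div P" for n
  have P: "P > 0" by (simp add: P_def prime_gt_0_nat[OF prime_CHAR_finite_field])
  have e_eq: "e n = P * e' n" for n using dvd(1) by (simp add: e'_def P_def)
  have "strict_mono e'"
    using e P by (auto simp: strict_mono_def e_eq)
  moreover have "\<not> CHAR('a) dvd e' n" for n
    using dvd(2)[of n] P by (auto simp: e_eq P_def mult.commute)
  ultimately have *: "haar_AE (\<lambda>x :: 'a fls. abs_p x > 1 \<longrightarrow> unif_distr haar_O (\<lambda>j. int_part (x ^ e' j)))"
    by (rule haar_AE_unif_distr_haar_O)
  have ip: "int_part (lift_O s c ^ e j) = frob_map k (int_part (lift_O s c ^ e' j))"
    for s j and c :: "nat \<Rightarrow> 'a"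
    by (simp add: e_eq P_def int_part_lift_O_power_prime_power frob_map_def fun_eq_iff)
  show ?thesis
    unfolding haar_AE_def
  proof
    fix s
    from * have "AE c in haar_O. abs_p (lift_O s c :: 'a fls) > 1 \<longrightarrow>
        unif_distr haar_O (\<lambda>j. int_part (lift_O s c ^ e' j))"
      unfolding haar_AE_def by (rule spec)
    thus "AE c in haar_O. abs_p (lift_O s c :: 'a fls) > 1 \<longrightarrow>
        unif_distr (mu_k k) (\<lambda>j. int_part (lift_O s c ^ e j))"
      by (rule eventually_mono) (simp add: ip unif_distr_frob_map)
  qed
qed

section \<open>Averaging over the p-adic valuation of the exponent\<close>

text \<open>The number 0 belongs to no class, since every power divides it; enumeration therefore
  starts at a positive exponent.\<close>

definition val_set :: "nat \<Rightarrow> nat \<Rightarrow> nat set" where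
  "val_set p k = {n. p ^ k dvd n \<and> \<not> p ^ (k + 1) dvd n}"

lemma card_multiples_le:
  fixes m :: nat
  assumes "m > 0"
  shows "card {n. 0 < n \<and> n \<le> N \<and> m dvd n} = N div m"
proof -
  have "{n. 0 < n \<and> n \<le> N \<and> m dvd n} = (\<lambda>i. m * i) ` {0<..N div m}"
    using assms by (auto simp: less_eq_div_iff_mult_less_eq mult.commute elim!: dvdE)
  thus ?thesis using assms by (simp add: card_image inj_on_def)
qed

lemma div_nat_density:
  fixes m :: nat
  assumes "m > 0"
  shows "(\<lambda>N. real (N div m) / real N) \<longlonglongrightarrow> 1 / real m"
proof (rule LIM_zero_cancel, rule Lim_null_comparison)
  show "\<forall>\<^sub>F N in sequentially. norm (real (N div m) / real N - 1 / real m) \<le> 1 / real N"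
    using eventually_gt_at_top[of 0]
  proof eventually_elim
    case (elim N)
    have "real N = real (N div m) * real m + real (N mod m)"
      unfolding of_nat_mult[symmetric] of_nat_add[symmetric] by simp
    hence "real N / real m - real (N div m) = real (N mod m) / real m"
      using assms by (simp add: field_simps)
    moreover have "real (N mod m) / real m \<le> 1" using assms by (simp add: less_imp_le)
    moreover have "0 \<le> real (N mod m) / real m" by simp
    ultimately have "real N / real m - real (N div m) \<le> 1" "real (N div m) \<le> real N / real m"
      by linarith+
    hence "\<bar>real (N div m) - real N / real m\<bar> \<le> 1" by simp
    moreover have "real (N div m) / real N - 1 / real m = (real (N div m) - real N / real m) / real N"
      using elim assms by (simp add: field_simps)
    ultimately show ?case using elim by (simp add: divide_right_mono)
  qed
  show "(\<lambda>N. 1 / real N) \<longlonglongrightarrow> 0" by (rule lim_1_over_n)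
qed

text \<open>An increasing enumeration lists the members up to \<open>N\<close> before all others.
  This translates counting by the size of the exponent into counting by its index in the
  class.\<close>

lemma sum_enumerate_initial:
  fixes g :: "nat \<Rightarrow> real"
  assumes S: "infinite S"
  shows "(\<Sum>n\<in>S \<inter> {..N}. g n) = (\<Sum>j<card (S \<inter> {..N}). g (enumerate S j))"
proof -
  define J where "J = {j. enumerate S j \<le> N}"
  have "J \<subseteq> {..N}" using le_enumerate[OF S] by (auto simp: J_def intro: order.trans)
  hence fin: "finite J" by (rule finite_subset) simp
  have inj: "inj_on (enumerate S) J" using inj_enumerate[OF S] by (rule inj_on_subset) simp
  have im: "enumerate S ` J = S \<inter> {..N}"
    using S by (auto simp: J_def enumerate_in_set) (metis enumerate_Ex image_eqI mem_Collect_eq)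
  have "J = {..<card J}"
  proof -
    have "i \<in> J" if "j \<in> J" "i \<le> j" for i j
      using that S by (auto simp: J_def intro: order.trans[of _ "enumerate S j"])
    then obtain m where "J = {..<m}"
    proof -
      define m where "m = (LEAST m. m \<notin> J)"
      have "\<exists>m. m \<notin> J" using fin by (metis ex_new_if_finite infinite_UNIV_nat)
      hence "m \<notin> J" unfolding m_def by (rule LeastI_ex)
      hence "J = {..<m}"
        using \<open>\<And>j i. j \<in> J \<Longrightarrow> i \<le> j \<Longrightarrow> i \<in> J\<close> not_less_Least[of _ "\<lambda>m. m \<notin> J"]
        unfolding m_def[symmetric] by (auto simp: not_less[symmetric])
      thus ?thesis using that by blast
    qed
    thus ?thesis by simp
  qed
  moreover have "card (S \<inter> {..N}) = card J" by (simp add: im[symmetric] card_image inj)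
  ultimately show ?thesis
    by (simp add: im[symmetric] sum.reindex[OF inj])
qed

context
  fixes p :: nat
  assumes p: "p > 1"
begin

lemma card_val_set: "card (val_set p k \<inter> {0<..N}) = N div p ^ k - N div p ^ Suc k"
proof -
  have "val_set p k \<inter> {0<..N} = {n. 0 < n \<and> n \<le> N \<and> p ^ k dvd n} - {n. 0 < n \<and> n \<le> N \<and> p ^ Suc k dvd n}"
    by (auto simp: val_set_def)
  moreover have "{n. 0 < n \<and> n \<le> N \<and> p ^ Suc k dvd n} \<subseteq> {n. 0 < n \<and> n \<le> N \<and> p ^ k dvd n}"
    by (auto dest: dvd_mult_right)
  ultimately show ?thesis
    using p by (simp add: card_Diff_subset card_multiples_le finite_subset[of _ "{..N}"] subset_iff del: power_Suc)
qed

lemma val_set_density: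
  "(\<lambda>N. real (card (val_set p k \<inter> {0<..N})) / real N) \<longlonglongrightarrow> (1 - 1 / real p) * (1 / real p ^ k)"
proof -
  have "N div p ^ Suc k \<le> N div p ^ k" for N
    using p by (intro div_le_mono2) auto
  hence "(\<lambda>N. real (card (val_set p k \<inter> {0<..N})) / real N)
      = (\<lambda>N. real (N div p ^ k) / real N - real (N div p ^ Suc k) / real N)"
    by (simp add: card_val_set diff_divide_distrib of_nat_diff del: power_Suc)
  moreover have "\<dots> \<longlonglongrightarrow> 1 / real (p ^ k) - 1 / real (p ^ Suc k)"
    using p by (intro tendsto_diff div_nat_density) simp_all
  moreover have "1 / real (p ^ k) - 1 / real (p ^ Suc k) = (1 - 1 / real p) * (1 / real p ^ k)"
    using p by (simp add: field_simps)
  ultimately show ?thesis by simp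
qed

lemma filterlim_card_val_set: "filterlim (\<lambda>N. card (val_set p k \<inter> {0<..N})) at_top sequentially"
proof -
  have "filterlim (\<lambda>N. real (card (val_set p k \<inter> {0<..N})) / real N * real N) at_top sequentially"
    using p by (intro filterlim_tendsto_pos_mult_at_top[OF val_set_density]) (auto intro: filterlim_real_sequentially)
  moreover have "real (card (val_set p k \<inter> {0<..N})) / real N * real N
      = real (card (val_set p k \<inter> {0<..N}))" for N by (cases "N = 0") auto
  ultimately show ?thesis by (simp add: filterlim_sequentially_iff_filterlim_real)
qed

lemma infinite_val_set: "infinite (val_set p k)"
proof
  assume fin: "finite (val_set p k)"
  have "eventually (\<lambda>N. card (val_set p k) + 1 \<le> card (val_set p k \<inter> {0<..N})) sequentially"
    using filterlim_card_val_set by (simp add: filterlim_at_top)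
  then obtain N where "card (val_set p k) + 1 \<le> card (val_set p k \<inter> {0<..N})"
    by (auto simp: eventually_at_top_linorder)
  moreover have "card (val_set p k \<inter> {0<..N}) \<le> card (val_set p k)"
    by (rule card_mono[OF fin]) auto
  ultimately show False by simp
qed

text \<open>If p^k divides n in this range, then k < p^k \<le> n \<le> N, so finitely many classes
  exhaust it.\<close>

lemma val_set_cover: "{0<..N} = (\<Union>k<N. val_set p k \<inter> {0<..N})"
proof (intro equalityI subsetI)
  fix n assume n: "n \<in> {0<..N}"
  have ex: "\<not> p ^ (n + 1) dvd n"
  proof
    assume "p ^ (n + 1) dvd n"
    hence "p ^ (n + 1) \<le> n" using n by (intro dvd_imp_le) auto
    moreover have "n + 1 < p ^ (n + 1)" using p by (intro power_gt_expt) simp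
    ultimately show False by simp
  qed
  define k where "k = (LEAST k. \<not> p ^ (k + 1) dvd n)"
  have "\<not> p ^ (k + 1) dvd n" unfolding k_def by (rule LeastI) (rule ex)
  moreover have dvd: "p ^ k dvd n"
  proof (cases k)
    case (Suc l)
    hence "l < (LEAST k. \<not> p ^ (k + 1) dvd n)" by (simp add: k_def)
    from not_less_Least[OF this] show ?thesis using Suc by simp
  qed simp
  moreover have "k < N"
  proof -
    have "k < p ^ k" using p by (intro power_gt_expt) simp
    also have "\<dots> \<le> n" using dvd n by (intro dvd_imp_le) auto
    finally show ?thesis using n by simp
  qed
  ultimately show "n \<in> (\<Union>k<N. val_set p k \<inter> {0<..N})"
    using n by (auto simp: val_set_def)
qed auto

lemma val_set_disjoint: "k \<noteq> l \<Longrightarrow> val_set p k \<inter> val_set p l = {}"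
proof (induction k l rule: linorder_wlog)
  case (le k l)
  hence "p ^ (k + 1) dvd p ^ l" by (intro le_imp_power_dvd) simp
  thus ?case by (auto simp: val_set_def dest: dvd_trans)
qed (auto simp: Int_commute)

lemma average_tendsto_val_sets:
  fixes g :: "nat \<Rightarrow> real"
  assumes g: "\<And>n. \<bar>g n\<bar> \<le> 1"
    and lim: "\<And>k. (\<lambda>N. (\<Sum>j<N. g (enumerate (val_set p k) j)) / real N) \<longlonglongrightarrow> m k"
  shows "(\<lambda>N. (\<Sum>n<N. g (Suc n)) / real N) \<longlonglongrightarrow> (\<Sum>k. (1 - 1 / real p) * (1 / real p ^ k) * m k)"
proof -
  define c where "c k N = card (val_set p k \<inter> {0<..N})" for k N
  define a where "a k N = (\<Sum>n\<in>val_set p k \<inter> {0<..N}. g n) / real N" for k N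
  \<comment> \<open>Class \<open>k\<close> has at most \<open>N\<close> / p^k members up to
    \<open>N\<close>. This bound is uniform in \<open>N\<close> and summable in \<open>k\<close>,
    the domination that Tannery's theorem asks for.\<close>
  have a_le: "\<bar>a k N\<bar> \<le> (1 / real p) ^ k" for k N
  proof (cases "N = 0")
    case False
    have "\<bar>\<Sum>n\<in>val_set p k \<inter> {0<..N}. g n\<bar> \<le> (\<Sum>n\<in>val_set p k \<inter> {0<..N}. 1)"
      by (intro order.trans[OF sum_abs] sum_mono g)
    also have "\<dots> \<le> real (N div p ^ k)" by (simp add: card_val_set)
    also have "\<dots> \<le> real N / real (p ^ k)" by (rule of_nat_div_le_of_nat)
    finally show ?thesis using False by (simp add: a_def power_one_over pos_divide_le_eq)
  qed (simp add: a_def)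
  have a_lim: "a k \<longlonglongrightarrow> (1 - 1 / real p) * (1 / real p ^ k) * m k" for k
  proof -
    have "val_set p k \<inter> {0<..N} = val_set p k \<inter> {..N}" for N
      by (auto simp: val_set_def Suc_le_eq intro: Nat.gr0I)
    hence "(\<Sum>n\<in>val_set p k \<inter> {0<..N}. g n) = (\<Sum>j<c k N. g (enumerate (val_set p k) j))" for N
      using sum_enumerate_initial[OF infinite_val_set] by (simp add: c_def)
    \<comment> \<open>The share of the class times the average along the class; both sides are 0
      when the class has no member up to \<open>N\<close>.\<close>
    hence "a k = (\<lambda>N. real (c k N) / real N *
        ((\<Sum>j<c k N. g (enumerate (val_set p k) j)) / real (c k N)))"
      by (auto simp: a_def fun_eq_iff)
    moreover have "\<dots> \<longlonglongrightarrow> (1 - 1 / real p) * (1 / real p ^ k) * m k"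
      unfolding c_def
      by (intro tendsto_mult val_set_density filterlim_compose[OF lim filterlim_card_val_set])
    ultimately show ?thesis by simp
  qed
  have a_sum: "(\<Sum>k. a k N) = (\<Sum>n<N. g (Suc n)) / real N" for N
  proof -
    have zero: "a k N = 0" if "k \<notin> {..<N}" for k
    proof -
      have "val_set p k \<inter> {0<..N} = {}"
      proof (rule equals0I)
        fix n assume n: "n \<in> val_set p k \<inter> {0<..N}"
        then obtain l where "l < N" "n \<in> val_set p l" using val_set_cover[of N] by blast
        thus False using val_set_disjoint[of k l] n that by auto
      qed
      thus ?thesis by (simp add: a_def)
    qed
    have "(\<Sum>k. a k N) = (\<Sum>k<N. a k N)"
      by (rule suminf_finite[OF finite_lessThan zero])
    also have "\<dots> = (\<Sum>k<N. \<Sum>n\<in>val_set p k \<inter> {0<..N}. g n) / real N"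
      by (simp add: a_def sum_divide_distrib)
    also have "(\<Sum>k<N. \<Sum>n\<in>val_set p k \<inter> {0<..N}. g n) = sum g (\<Union>k<N. val_set p k \<inter> {0<..N})"
      using val_set_disjoint by (intro sum.UNION_disjoint[symmetric]) auto
    also have "\<dots> = sum g {0<..N}" using val_set_cover[of N] by (rule arg_cong[where f = "sum g", symmetric])
    also have "\<dots> = (\<Sum>n<N. g (Suc n))"
      by (rule sum.reindex_bij_witness[of _ Suc "\<lambda>n. n - 1"]) auto
    finally show ?thesis .
  qed
  have "summable (\<lambda>k. (1 / real p) ^ k)" using p by (intro summable_geometric) simp
  moreover have "\<forall>\<^sub>F (k, N) in sequentially \<times>\<^sub>F sequentially. norm (a k N) \<le> (1 / real p) ^ k"
    using a_le by (intro always_eventually) auto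
  ultimately have "(\<lambda>N. \<Sum>k. a k N) \<longlonglongrightarrow> (\<Sum>k. (1 - 1 / real p) * (1 / real p ^ k) * m k)"
    using tannerys_theorem[where a = a, OF a_lim] sequentially_bot by blast
  thus ?thesis by (simp only: a_sum)
qed

end

section \<open>The mixture of the measures mu_k\<close>

lemma mu_star_weight_sums:
  fixes p :: nat
  assumes "p > 1"
  shows "(\<lambda>k. (1 - 1 / real p) * (1 / real p ^ k)) sums 1"
proof -
  have "(\<lambda>k. (1 - 1 / real p) * (1 / real p) ^ k) sums ((1 - 1 / real p) * (1 / (1 - 1 / real p)))"
    using assms by (intro sums_mult geometric_sums) simp
  thus ?thesis using assms by (simp add: power_one_over)
qed

text \<open>\<open>measure_of\<close> returns the prescribed values once the set function is known
  to be countably additive. Reading \<open>haar_O\<close> as \<open>mu_k 0\<close> merges its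
  summand into one series with weights (1 - 1/p) p^(-k), and additivity becomes an exchange of two
  nonnegative series.\<close>

lemma
  shows sets_mu_star: "sets (mu_star :: (nat \<Rightarrow> 'a::{finite,field}) measure) = sets haar_O"
    and emeasure_mu_star: "A \<in> sets haar_O \<Longrightarrow> emeasure (mu_star :: (nat \<Rightarrow> 'a) measure) A
      = (\<Sum>k. ennreal ((1 - 1 / real CHAR('a)) * (1 / real CHAR('a) ^ k)) * emeasure (mu_k k) A)"
proof -
  have p: "CHAR('a) > 1" using prime_gt_1_nat[OF prime_CHAR_finite_field] .
  define F where "F A = (\<Sum>k. ennreal ((1 - 1 / real CHAR('a)) * (1 / real CHAR('a) ^ k)) * emeasure (mu_k k) A)"
    for A :: "(nat \<Rightarrow> 'a) set"
  have F_eq: "F A = ennreal (1 - 1 / real CHAR('a)) * (emeasure haar_O A +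
      (\<Sum>k. ennreal (1 / real CHAR('a) ^ Suc k) * emeasure (mu_k (Suc k)) A))" for A
  proof -
    have "F A = (\<Sum>k. ennreal (1 - 1 / real CHAR('a)) * (ennreal (1 / real CHAR('a) ^ k) * emeasure (mu_k k) A))"
    proof -
      have "ennreal ((1 - 1 / real CHAR('a)) * (1 / real CHAR('a) ^ k))
          = ennreal (1 - 1 / real CHAR('a)) * ennreal (1 / real CHAR('a) ^ k)" for k
        using p by (intro ennreal_mult) auto
      thus ?thesis by (simp only: F_def mult.assoc)
    qed
    also have "\<dots> = ennreal (1 - 1 / real CHAR('a)) * (\<Sum>k. ennreal (1 / real CHAR('a) ^ k) * emeasure (mu_k k) A)"
      by (rule ennreal_suminf_cmult)
    also have "(\<Sum>k. ennreal (1 / real CHAR('a) ^ k) * emeasure (mu_k k) A)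
        = (\<Sum>k. ennreal (1 / real CHAR('a) ^ Suc k) * emeasure (mu_k (Suc k)) A) + emeasure haar_O A"
      by (subst suminf_offset[where i = 1]) (simp_all add: mu_k_0)
    finally show ?thesis by (simp add: add.commute)
  qed
  have mu: "(mu_star :: (nat \<Rightarrow> 'a) measure) = measure_of UNIV (sets haar_O) F"
    unfolding mu_star_def F_eq ..
  have sa: "sigma_algebra UNIV (sets (haar_O :: (nat \<Rightarrow> 'a) measure))"
    using sets.sigma_algebra_axioms[of "haar_O :: (nat \<Rightarrow> 'a) measure"] by simp
  show "sets (mu_star :: (nat \<Rightarrow> 'a) measure) = sets haar_O"
    unfolding mu using sa by (simp add: sigma_algebra.sigma_sets_eq)
  have "countably_additive (sets haar_O) F"
  proof (rule countably_additiveI)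
    fix A :: "nat \<Rightarrow> (nat \<Rightarrow> 'a) set"
    assume A: "range A \<subseteq> sets haar_O" "disjoint_family A"
    define f where "f i k = ennreal ((1 - 1 / real CHAR('a)) * (1 / real CHAR('a) ^ k)) * emeasure (mu_k k) (A i)" for i k
    \<comment> \<open>Writing the inner series as an integral over counting measure turns the
      exchange into monotone convergence.\<close>
    have "(\<Sum>i. F (A i)) = (\<Sum>i. \<integral>\<^sup>+k. f i k \<partial>count_space UNIV)"
      by (simp add: F_def f_def nn_integral_count_space_nat)
    also have "\<dots> = (\<integral>\<^sup>+k. (\<Sum>i. f i k) \<partial>count_space UNIV)"
      by (rule nn_integral_suminf[symmetric]) simp
    also have "\<dots> = (\<Sum>k. \<Sum>i. f i k)" by (rule nn_integral_count_space_nat)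
    also have "\<dots> = F (\<Union>i. A i)"
    proof -
      have "(\<Sum>i. f i k) = ennreal ((1 - 1 / real CHAR('a)) * (1 / real CHAR('a) ^ k)) * (\<Sum>i. emeasure (mu_k k) (A i))" for k
        unfolding f_def by (rule ennreal_suminf_cmult)
      moreover have "(\<Sum>i. emeasure (mu_k k) (A i)) = emeasure (mu_k k) (\<Union>i. A i)" for k
        by (rule suminf_emeasure) (use A in \<open>simp_all add: sets_mu_k\<close>)
      ultimately show ?thesis by (simp only: F_def)
    qed
    finally show "(\<Sum>i. F (A i)) = F (\<Union>i. A i)" .
  qed
  moreover have "positive (sets haar_O) F" by (simp add: positive_def F_def)
  moreover assume "A \<in> sets haar_O"
  ultimately show "emeasure (mu_star :: (nat \<Rightarrow> 'a) measure) A
      = (\<Sum>k. ennreal ((1 - 1 / real CHAR('a)) * (1 / real CHAR('a) ^ k)) * emeasure (mu_k k) A)"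
    unfolding mu F_def[symmetric] by (intro emeasure_measure_of_sigma sa)
qed

lemma measure_mu_star:
  fixes A :: "(nat \<Rightarrow> 'a::{finite,field}) set"
  assumes A: "A \<in> sets haar_O"
  shows "measure mu_star A = (\<Sum>k. (1 - 1 / real CHAR('a)) * (1 / real CHAR('a) ^ k) * measure (mu_k k) A)"
proof -
  have p: "CHAR('a) > 1" using prime_gt_1_nat[OF prime_CHAR_finite_field] .
  define r where "r k = (1 - 1 / real CHAR('a)) * (1 / real CHAR('a) ^ k)" for k
  have r: "r k \<ge> 0" for k using p by (simp add: r_def)
  have m: "emeasure (mu_k k) A = ennreal (measure (mu_k k) A)" "measure (mu_k k) A \<le> 1" for k
  proof -
    interpret prob_space "mu_k k :: (nat \<Rightarrow> 'a) measure" by (rule prob_space_mu_k)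
    show "emeasure (mu_k k) A = ennreal (measure (mu_k k) A)" "measure (mu_k k) A \<le> 1"
      by (simp_all add: emeasure_eq_measure)
  qed
  have sm: "summable (\<lambda>k. r k * measure (mu_k k) A)"
  proof (rule summable_comparison_test')
    show "summable r" unfolding r_def using mu_star_weight_sums[OF p] by (rule sums_summable)
    show "norm (r k * measure (mu_k k) A) \<le> r k" for k
      using r[of k] m(2)[of k] by (simp add: mult_left_le)
  qed
  have "emeasure mu_star A = (\<Sum>k. ennreal (r k * measure (mu_k k) A))"
    unfolding emeasure_mu_star[OF A] r_def[symmetric] using r by (intro suminf_cong) (simp add: m(1) ennreal_mult)
  also have "\<dots> = ennreal (\<Sum>k. r k * measure (mu_k k) A)"
    using r by (intro suminf_ennreal2 sm) simp
  finally show ?thesis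
    using r suminf_nonneg[OF sm] unfolding measure_def[of mu_star] r_def[symmetric] by simp
qed

lemma prob_space_mu_star: "prob_space (mu_star :: (nat \<Rightarrow> 'a::{finite,field}) measure)"
proof
  have p: "CHAR('a) > 1" using prime_gt_1_nat[OF prime_CHAR_finite_field] .
  have sp: "space (mu_star :: (nat \<Rightarrow> 'a) measure) = UNIV"
    using sets_eq_imp_space_eq[OF sets_mu_star[where 'a = 'a]] by simp
  have one: "emeasure (mu_k k) (UNIV :: (nat \<Rightarrow> 'a) set) = 1" for k
    using prob_space.emeasure_space_1[OF prob_space_mu_k[where 'a = 'a, of k]]
      sets_eq_imp_space_eq[OF sets_mu_k[where 'a = 'a, of k]] by simp
  have UN: "(UNIV :: (nat \<Rightarrow> 'a) set) \<in> sets haar_O"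
    using sets.top[of "haar_O :: (nat \<Rightarrow> 'a) measure"] by simp
  have "emeasure (mu_star :: (nat \<Rightarrow> 'a) measure) UNIV
      = (\<Sum>k. ennreal ((1 - 1 / real CHAR('a)) * (1 / real CHAR('a) ^ k)))"
    unfolding emeasure_mu_star[OF UN] one by simp
  also have "\<dots> = ennreal (\<Sum>k. (1 - 1 / real CHAR('a)) * (1 / real CHAR('a) ^ k))"
    using p mu_star_weight_sums[OF p] by (intro suminf_ennreal2) (auto intro: sums_summable)
  also have "\<dots> = 1" using mu_star_weight_sums[OF p] by (simp add: sums_iff)
  finally show "emeasure (mu_star :: (nat \<Rightarrow> 'a) measure) (space mu_star) = 1" by (simp add: sp)
qed

text \<open>Indicators of sets decided by finitely many coordinates are continuous, hence admissible
  test functions; this is the converse of the disk criterion.\<close>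

lemma unif_distr_frequency:
  fixes \<nu> :: "(nat \<Rightarrow> 'a::finite) measure"
  assumes "unif_distr \<nu> s" "sets \<nu> = sets haar_O"
    and loc: "\<And>c c'. (\<forall>i<L. c i = c' i) \<Longrightarrow> c \<in> A \<longleftrightarrow> c' \<in> A"
  shows "(\<lambda>N. (\<Sum>n<N. indicator A (s n)) / real N) \<longlonglongrightarrow> measure \<nu> A"
proof -
  have "continuous_map O_top euclideanreal (indicat_real A)"
  proof (rule continuous_map_O_top_local[where L = L])
    fix c c' :: "nat \<Rightarrow> 'a" assume "\<forall>i<L. c i = c' i"
    from loc[OF this] show "indicat_real A c = indicat_real A c'" by (simp add: indicator_def)
  qed
  hence "(\<lambda>N. (\<Sum>n<N. indicat_real A (s n)) / real N) \<longlonglongrightarrow> integral\<^sup>L \<nu> (indicat_real A)"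
    using assms(1) unfolding unif_distr_def by blast
  moreover have "space \<nu> = UNIV" using sets_eq_imp_space_eq[OF assms(2)] by simp
  ultimately show ?thesis by simp
qed

lemma unif_distr_mu_star:
  fixes y :: "nat \<Rightarrow> nat \<Rightarrow> 'a::{finite,field}"
  assumes "\<And>k. unif_distr (mu_k k) (\<lambda>j. y (enumerate (val_set CHAR('a) k) j))"
  shows "unif_distr mu_star (\<lambda>j. y (Suc j))"
proof (rule unif_distrI_cyl[OF prob_space_mu_star sets_mu_star])
  fix w :: "'a list"
  have "(\<lambda>N. (\<Sum>j<N. indicat_real (cyl w) (y (enumerate (val_set CHAR('a) k) j))) / real N)
      \<longlonglongrightarrow> measure (mu_k k) (cyl w)" for k
    by (rule unif_distr_frequency[OF assms sets_mu_k, where L = "length w"]) (simp add: cyl_def)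
  hence "(\<lambda>N. (\<Sum>n<N. indicat_real (cyl w) (y (Suc n))) / real N)
      \<longlonglongrightarrow> (\<Sum>k. (1 - 1 / real CHAR('a)) * (1 / real CHAR('a) ^ k) * measure (mu_k k) (cyl w))"
    by (intro average_tendsto_val_sets prime_gt_1_nat prime_CHAR_finite_field) (simp_all add: indicator_def)
  thus "(\<lambda>N. (\<Sum>n<N. indicat_real (cyl w) (y (Suc n))) / real N) \<longlonglongrightarrow> measure mu_star (cyl w)"
    by (simp add: measure_mu_star cyl_in_sets)
qed

lemma not_unif_distr_haar_O_powers:
  fixes x :: "'a::{finite,field} fls"
  shows "\<not> unif_distr haar_O (\<lambda>j. int_part (x ^ Suc j))"
proof
  define p where "p = CHAR('a)"
  have p: "p > 1" unfolding p_def using prime_gt_1_nat[OF prime_CHAR_finite_field] .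
  \<comment> \<open>All these indices are 1 modulo \<open>p\<close>, so the coordinates vanish at
    every exponent divisible by \<open>p\<close>. A single index would have Haar probability 1/q,
    which for q = p is not below the frequency 1/p; with \<open>p\<close> of them it is q^(-p) \<le>
    2^(-p) < 1/p.\<close>
  define J where "J = (\<lambda>i. p * i + 1) ` {..<p}"
  define A where "A = {c :: nat \<Rightarrow> 'a. \<forall>j\<in>J. c j = 0}"
  assume "unif_distr haar_O (\<lambda>j. int_part (x ^ Suc j))"
  hence "(\<lambda>N. (\<Sum>n<N. indicator A (int_part (x ^ Suc n))) / real N) \<longlonglongrightarrow> measure haar_O A"
  proof (rule unif_distr_frequency[where L = "p * p + 1"])
    fix c c' :: "nat \<Rightarrow> 'a" assume eq: "\<forall>i<p * p + 1. c i = c' i"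
    have "J \<subseteq> {..<p * p + 1}" using p by (auto simp: J_def)
    thus "c \<in> A \<longleftrightarrow> c' \<in> A" using eq by (auto simp: A_def subset_iff)
  qed simp
  \<comment> \<open>Among the first \<open>p * Suc M\<close> exponents exactly \<open>Suc M\<close>
    are multiples of \<open>p\<close>, so at these lengths the bound 1/p holds without
    rounding.\<close>
  moreover have "filterlim (\<lambda>M. p * Suc M) at_top sequentially"
    using p by (intro filterlim_subseq) (auto simp: strict_mono_Suc_iff)
  ultimately have "(\<lambda>M. (\<Sum>n<p * Suc M. indicator A (int_part (x ^ Suc n))) / real (p * Suc M)) \<longlonglongrightarrow> measure haar_O A"
    by (rule filterlim_compose)
  moreover have "1 / real p \<le> (\<Sum>n<p * Suc M. indicator A (int_part (x ^ Suc n))) / real (p * Suc M)" for M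
  proof -
    obtain s c where x: "x = lift_O s c" by (rule lift_O_surj)
    have "\<not> p dvd p * i + 1" for i
      using p dvd_add_right_iff[of p "p * i" 1] by simp
    hence in_A: "int_part (x ^ (p * m)) \<in> A" for m
      using int_part_lift_O_power_prime_power[of s c 1 m]
      unfolding A_def J_def x p_def power_one_right by simp
    \<comment> \<open>Position n carries the exponent \<open>Suc n\<close>, so the multiples of
      \<open>p\<close> sit at the positions \<open>p * m + (p - 1)\<close>.\<close>
    have inj: "inj_on (\<lambda>m. p * m + (p - 1)) {..<Suc M}"
      using p by (intro inj_onI) (metis add_right_cancel mult_cancel1 not_one_less_zero)
    have "real (Suc M) = (\<Sum>m<Suc M. indicator A (int_part (x ^ Suc (p * m + (p - 1)))))"
    proof -
      have "Suc (p * m + (p - 1)) = p * Suc m" for m using p by simp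
      thus ?thesis using in_A by (simp only: indicator_simps) simp
    qed
    also have "\<dots> = (\<Sum>n\<in>(\<lambda>m. p * m + (p - 1)) ` {..<Suc M}. indicator A (int_part (x ^ Suc n)))"
      by (simp only: sum.reindex[OF inj] o_def)
    also have "\<dots> \<le> (\<Sum>n<p * Suc M. indicator A (int_part (x ^ Suc n)))"
    proof (rule sum_mono2)
      have "p * m + (p - 1) < p * Suc M" if "m < Suc M" for m
      proof -
        have "p * m + (p - 1) < p * Suc m" using p by simp
        also have "\<dots> \<le> p * Suc M" using that by (intro mult_le_mono2) simp
        finally show ?thesis .
      qed
      thus "(\<lambda>m. p * m + (p - 1)) ` {..<Suc M} \<subseteq> {..<p * Suc M}" by auto
    qed auto
    finally have "real (Suc M) / real (p * Suc M)
        \<le> (\<Sum>n<p * Suc M. indicator A (int_part (x ^ Suc n))) / real (p * Suc M)"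
      by (rule divide_right_mono) simp
    moreover have "real (Suc M) / real (p * Suc M) = 1 / real p"
      unfolding of_nat_mult using p by simp
    ultimately show ?thesis by simp
  qed
  ultimately have "1 / real p \<le> measure haar_O A"
    by (intro LIMSEQ_le_const) auto
  also have "measure haar_O A = 1 / real CARD('a) ^ p"
  proof -
    have "card J = p" unfolding J_def using p by (subst card_image) (auto simp: inj_on_def)
    thus ?thesis
      unfolding A_def using measure_haar_O_Collect[of J "\<lambda>_. 0 :: 'a"] by (simp add: J_def)
  qed
  also have "\<dots> < 1 / real p"
  proof -
    have "card {0, 1 :: 'a} \<le> CARD('a)" by (rule card_mono) auto
    hence "2 ^ p \<le> CARD('a) ^ p" by (intro power_mono) auto
    moreover have "p < 2 ^ p" by (rule less_exp)
    ultimately have "p < CARD('a) ^ p" by (rule less_le_trans[rotated])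
    hence "real p < real CARD('a) ^ p" unfolding of_nat_power[symmetric] by (rule of_nat_less_iff[THEN iffD2])
    thus ?thesis using p by (intro divide_strict_left_mono) auto
  qed
  finally show False by simp
qed

theorem theorem1p4:
  fixes dummy :: "'a::{finite,field} itself"
  defines "p \<equiv> CHAR('a)"
  shows "(\<forall>x::'a fls. abs_p x > 1 \<longrightarrow>
            \<not> unif_distr haar_O (\<lambda>j. int_part (x ^ Suc j)))
       \<and> (\<forall>k::nat. k \<ge> 1 \<longrightarrow>
            haar_AE (\<lambda>x::'a fls. abs_p x > 1 \<longrightarrow>
              unif_distr (mu_k k)
                (\<lambda>j. int_part (x ^ enumerate {n. p ^ k dvd n \<and> \<not> p ^ (k + 1) dvd n} j))))
       \<and> haar_AE (\<lambda>x::'a fls. abs_p x > 1 \<longrightarrow>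
            unif_distr mu_star (\<lambda>j. int_part (x ^ Suc j)))"
proof -
  have p: "p > 1" unfolding p_def using prime_gt_1_nat[OF prime_CHAR_finite_field] .
  \<comment> \<open>The class \<open>k = 0\<close> is included: (b) does not mention it, but the
    mixture in (c) runs over all classes, with one null set for the countably many
    \<open>k\<close>.\<close>
  have b: "haar_AE (\<lambda>x::'a fls. abs_p x > 1 \<longrightarrow>
      unif_distr (mu_k k) (\<lambda>j. int_part (x ^ enumerate (val_set p k) j)))" for k
  proof (rule haar_AE_unif_distr_mu_k)
    show "strict_mono (enumerate (val_set p k))"
      by (rule strict_mono_enumerate[OF infinite_val_set[OF p]])
    fix n
    have "enumerate (val_set p k) n \<in> val_set p k"
      by (rule enumerate_in_set[OF infinite_val_set[OF p]])
    thus "CHAR('a) ^ k dvd enumerate (val_set p k) n" "\<not> CHAR('a) ^ Suc k dvd enumerate (val_set p k) n"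
      by (simp_all add: val_set_def p_def)
  qed
  have "haar_AE (\<lambda>x::'a fls. abs_p x > 1 \<longrightarrow> unif_distr mu_star (\<lambda>j. int_part (x ^ Suc j)))"
    unfolding haar_AE_def
  proof
    fix s
    have "AE c in haar_O. \<forall>k. abs_p (lift_O s c :: 'a fls) > 1 \<longrightarrow>
        unif_distr (mu_k k) (\<lambda>j. int_part (lift_O s c ^ enumerate (val_set p k) j))"
      unfolding AE_all_countable using b unfolding haar_AE_def by blast
    thus "AE c in haar_O. abs_p (lift_O s c :: 'a fls) > 1 \<longrightarrow>
        unif_distr mu_star (\<lambda>j. int_part (lift_O s c ^ Suc j))"
      by (rule eventually_mono)
         (auto simp del: power_Suc simp: p_def intro!: unif_distr_mu_star[where y = "\<lambda>n. int_part (lift_O s _ ^ n)"])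
  qed
  thus ?thesis
    using b not_unif_distr_haar_O_powers unfolding val_set_def by blast
qed

end
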